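(* Every non-trivial separable connected compact topological group is $d$-independent.
   Context: All topological groups are Hausdorff; groups are not assumed abelian. $\mathfrak c=|\mathbb R|$. Separable means having a countable dense subset. A non-trivial topological group $G$ is called $d$-independent if for every subgroup $S\le G$ with $|S|<\mathfrak c$ there exists a countable dense subgroup $D$ of $G$ such that $S\cap D=\{1\}$. *)

theory Defs
  imports "HOL-Analysis.Analysis" "HOL-Algebra.Group"
begin

text \<open>
  The type class \<open>topological_group_add\<close> of the library equips a whole type with an (additively
  written) group structure. Here a topological group is instead a not necessarily abelian group
  \<open>G\<close> on an explicit carrier together with a topology \<open>T\<close> on that carrier; as usual in
  this area, it is Hausdorff by convention.
\<close>

locale topological_group = group G
  for G (structure) +
  fixes T :: "'a topology"
  assumes topspace_eq_carrier: "topspace T = carrier G"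
    and Hausdorff: "Hausdorff_space T"
    and continuous_mult: "continuous_map (prod_topology T T) T (\<lambda>(x, y). x \<otimes> y)"
    and continuous_inv: "continuous_map T T (\<lambda>x. inv x)"

definition nontrivial_group :: "('a, 'b) monoid_scheme \<Rightarrow> bool" where
  "nontrivial_group G \<longleftrightarrow> carrier G \<noteq> {\<one>\<^bsub>G\<^esub>}"

text \<open>
  The hypothesis that the cardinality of \<open>S\<close> is less than the continuum is expressed by
  \<open>S \<prec> (UNIV :: real set)\<close>, since \<open>card\<close> is meaningful for finite sets only.
\<close>

definition d_independent :: "('a, 'b) monoid_scheme \<Rightarrow> 'a topology \<Rightarrow> bool" where
  "d_independent G T \<longleftrightarrow>
     topological_group G T \<and> nontrivial_group G \<and>
     (\<forall>S. subgroup S G \<and> S \<prec> (UNIV :: real set) \<longrightarrow>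
        (\<exists>D. subgroup D G \<and> countable D \<and> T closure_of D = topspace T \<and>
             S \<inter> D = {\<one>\<^bsub>G\<^esub>}))"

end

theory Submission
  imports Defs "HOL-Complex_Analysis.Great_Picard"
begin

text \<open>
  It suffices to find continuum many countable dense subgroups of \<open>G\<close> that pairwise meet in \<open>{\<one>}\<close>:
  if all of them met \<open>S\<close> nontrivially, they would give continuum many different elements of \<open>S\<close>.

  For every group word \<open>w\<close> that is not a law of \<open>G\<close>, the Peter-Weyl theorem provides a
  finite-dimensional representation with a matrix coefficient that is not constant on the values
  of \<open>w\<close>. As a function of each variable of \<open>w\<close> this coefficient has finite-dimensional span of
  translates, and on a connected group such a function is determined by its values on any nonempty
  open set. So the coefficient is nonconstant on every nonempty open set of tuples, and a
  Mycielski-type construction gives continuum many tuples \<open>\<phi> \<tau>\<close> such that the values of two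
  nonlaws at different \<open>\<phi> \<tau>\<close> and \<open>\<phi> \<tau>'\<close> are always separated by one of these countably many
  representations.

  These tuples are generic, and hence dense, only modulo the common kernel of the representations,
  as \<open>G\<close> need not be metrizable. But a sequence whose image accumulates at the image of a point
  \<open>x\<close> has a cluster point \<open>z\<close> in the same coset, and multiplying by \<open>z\<^sup>-\<^sup>1 x\<close> makes it accumulate at
  \<open>x\<close> without changing its image. Doing this for a countable dense set of points \<open>x\<close> makes the
  generated subgroups dense in \<open>G\<close>.
\<close>

section \<open>Compact spaces\<close>

text \<open>The generators of each subgroup are indexed by pairs \<open>(n, k)\<close>; row
  \<open>n\<close> is to accumulate at the \<open>n\<close>-th point of a countable dense set. A
  basic open set of tuples restricts only finitely many coordinates, so every row keeps a free entry
  and this demand never conflicts with genericity. There are only countably many words, so one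
  representation per nonlaw suffices and all demands form a sequence. To separate the values of
  \<open>w\<close> and \<open>w'\<close>, the representation of \<open>w\<close> alone serves: with
  the second tuple fixed, a coefficient that is nonconstant on every nonempty open set can be moved
  off one value. The analysis stays within continuous real functions. An invariant mean built from
  finite averages of translates plays the part of Haar integration, and limits come from an
  Arzela-Ascoli theorem in which separability replaces metrizability.\<close>

lemma continuous_map_realI:
  fixes f :: "'a \<Rightarrow> real"
  assumes "\<And>x e. x \<in> topspace X \<Longrightarrow> e > 0 \<Longrightarrow>
    \<exists>U. openin X U \<and> x \<in> U \<and> (\<forall>y\<in>U. \<bar>f y - f x\<bar> < e)"
  shows "continuous_map X euclideanreal f"
  unfolding continuous_map_eq_topcontinuous_at topcontinuous_at_def
proof (intro ballI conjI allI impI)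
  fix x V assume x: "x \<in> topspace X" and V: "openin euclideanreal V \<and> f x \<in> V"
  then obtain e where e: "e > 0" "ball (f x) e \<subseteq> V"
    by (metis open_contains_ball open_openin)
  obtain U where "openin X U" "x \<in> U" "\<forall>y\<in>U. \<bar>f y - f x\<bar> < e"
    using assms[OF x e(1)] by auto
  then show "\<exists>U. openin X U \<and> x \<in> U \<and> (\<forall>y\<in>U. f y \<in> V)"
    using e(2) by (intro exI[of _ U]) (auto simp: dist_real_def abs_minus_commute subset_iff)
qed auto

lemma compact_space_real_bounded:
  assumes "compact_space X" "continuous_map X euclideanreal f"
  obtains B where "B > 0" "\<And>x. x \<in> topspace X \<Longrightarrow> \<bar>f x\<bar> \<le> B"
proof -
  have "compactin euclideanreal (f ` topspace X)"
    using assms compact_space_def image_compactin by blast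
  then have "bounded (f ` topspace X)"
    by (simp add: compact_imp_bounded)
  then show thesis
    using that by (auto simp: bounded_pos)
qed

lemma compact_space_finite_subcover:
  assumes "compact_space X" "\<And>x. x \<in> topspace X \<Longrightarrow> openin X (N x) \<and> x \<in> N x"
  obtains F where "finite F" "F \<subseteq> topspace X" "\<And>y. y \<in> topspace X \<Longrightarrow> \<exists>x\<in>F. y \<in> N x"
proof -
  have "topspace X \<subseteq> \<Union>(N ` topspace X)" using assms(2) by blast
  moreover have "\<forall>U\<in>N ` topspace X. openin X U" using assms(2) by blast
  ultimately obtain \<F> where F: "finite \<F>" "\<F> \<subseteq> N ` topspace X" "topspace X \<subseteq> \<Union>\<F>"
    using assms(1) unfolding compact_space_alt by meson
  obtain F where "F \<subseteq> topspace X" "finite F" "\<F> = N ` F"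
    using finite_subset_image[OF F(1,2)] by blast
  with F(3) show thesis by (intro that[of F]) auto
qed

text \<open>The points where \<open>F\<close> is within \<open>e\<close> of its value on the slice
  at \<open>y\<close> form an open set containing that slice, so the tube lemma applies. This does
  the work of uniform continuity without a metric.\<close>

lemma continuous_map_uniform_in_first:
  fixes F :: "'a \<times> 'b \<Rightarrow> real"
  assumes "compact_space X" "continuous_map (prod_topology X Y) euclideanreal F"
    and "y \<in> topspace Y" "e > 0"
  obtains V where "openin Y V" "y \<in> V"
    "\<And>x y'. x \<in> topspace X \<Longrightarrow> y' \<in> V \<Longrightarrow> \<bar>F (x, y') - F (x, y)\<bar> < e"
proof -
  let ?P = "prod_topology X Y"
  have "continuous_map ?P ?P (\<lambda>p. (fst p, y))"
    using assms(3) by (auto intro!: continuous_intros)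
  then have "continuous_map ?P euclideanreal (F \<circ> (\<lambda>p. (fst p, y)))"
    using assms(2) continuous_map_compose by blast
  then have "continuous_map ?P euclideanreal (\<lambda>p. F p - F (fst p, y))"
    using assms(2) by (auto simp: o_def intro!: continuous_intros)
  then have W: "openin ?P {p \<in> topspace ?P. F p - F (fst p, y) \<in> ball 0 e}"
    by (rule openin_continuous_map_preimage) simp
  obtain U V where "openin X U" "openin Y V" "topspace X \<subseteq> U" "y \<in> V"
    and UV: "U \<times> V \<subseteq> {p \<in> topspace ?P. F p - F (fst p, y) \<in> ball 0 e}"
  proof -
    have "topspace X \<times> {y} \<subseteq> {p \<in> topspace ?P. F p - F (fst p, y) \<in> ball 0 e}"
      using assms(3,4) by auto
    with tube_lemma_left[OF W] assms(1,3) that show ?thesis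
      unfolding compact_space_def by blast
  qed
  show thesis
  proof (rule that[OF \<open>openin Y V\<close> \<open>y \<in> V\<close>])
    fix x y' assume "x \<in> topspace X" "y' \<in> V"
    then have "(x, y') \<in> U \<times> V" using \<open>topspace X \<subseteq> U\<close> by auto
    with UV show "\<bar>F (x, y') - F (x, y)\<bar> < e" by (fastforce simp: dist_real_def)
  qed
qed

text \<open>A diagonal subsequence converges on a countable dense set. Finitely many equicontinuity
  neighbourhoods cover the space and each contains a dense point, which makes the subsequence
  uniformly Cauchy.\<close>

lemma Arzela_Ascoli_separable:
  fixes F :: "nat \<Rightarrow> 'a \<Rightarrow> real"
  assumes "compact_space X" "separable_space X"
    and B: "\<And>n x. x \<in> topspace X \<Longrightarrow> \<bar>F n x\<bar> \<le> B"
    and eq: "\<And>x e. x \<in> topspace X \<Longrightarrow> e > 0 \<Longrightarrow>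
       \<exists>U. openin X U \<and> x \<in> U \<and> (\<forall>n. \<forall>y\<in>U. \<bar>F n y - F n x\<bar> < e)"
  obtains r h where "strict_mono (r :: nat \<Rightarrow> nat)" "continuous_map X euclideanreal h"
    "\<And>e. e > 0 \<Longrightarrow> \<exists>N. \<forall>n\<ge>N. \<forall>x\<in>topspace X. \<bar>F (r n) x - h x\<bar> < e"
proof -
  obtain C where C: "countable C" "C \<subseteq> topspace X" "X closure_of C = topspace X"
    using assms(2) unfolding separable_space_def by blast
  obtain r where r: "strict_mono (r :: nat \<Rightarrow> nat)"
    and conv: "\<And>x. x \<in> C \<Longrightarrow> \<exists>l. (\<lambda>n. F (r n) x) \<longlonglongrightarrow> l"
    using function_convergent_subsequence[of C F B] C B by (metis real_norm_def subsetD)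
  have cauchy: "\<exists>N. \<forall>m\<ge>N. \<forall>n\<ge>N. \<forall>x\<in>topspace X. \<bar>F (r m) x - F (r n) x\<bar> < e" if "e > 0" for e
  proof -
    \<comment> \<open>Five errors add up: from \<open>x\<close> to \<open>p\<close> and from
      \<open>p\<close> to \<open>c p\<close>, each for both indices, and the Cauchy error at
      \<open>c p\<close>.\<close>
    have e5: "e / 5 > 0" using that by simp
    obtain N where N: "\<And>x. x \<in> topspace X \<Longrightarrow>
        openin X (N x) \<and> x \<in> N x \<and> (\<forall>n. \<forall>y\<in>N x. \<bar>F n y - F n x\<bar> < e/5)"
      using eq[OF _ e5] by metis
    obtain P where P: "finite P" "P \<subseteq> topspace X" "\<And>y. y \<in> topspace X \<Longrightarrow> \<exists>x\<in>P. y \<in> N x"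
      using compact_space_finite_subcover[of X N] assms(1) N by metis
    have "\<exists>c\<in>C. c \<in> N p" if "p \<in> P" for p
      using C(3) N[of p] P(2) that by (metis in_closure_of subsetD)
    then obtain c where c: "\<And>p. p \<in> P \<Longrightarrow> c p \<in> C \<and> c p \<in> N p" by metis
    have "\<forall>p\<in>P. \<forall>\<^sub>F k in sequentially. \<forall>m\<ge>k. \<forall>n\<ge>k. \<bar>F (r m) (c p) - F (r n) (c p)\<bar> < e/5"
    proof
      fix p assume "p \<in> P"
      then have "Cauchy (\<lambda>n. F (r n) (c p))"
        using conv[of "c p"] c by (auto simp: convergent_def Cauchy_convergent_iff)
      then obtain k where "\<forall>m\<ge>k. \<forall>n\<ge>k. \<bar>F (r m) (c p) - F (r n) (c p)\<bar> < e/5"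
        using e5 unfolding Cauchy_def dist_real_def by blast
      then show "\<forall>\<^sub>F k in sequentially. \<forall>m\<ge>k. \<forall>n\<ge>k. \<bar>F (r m) (c p) - F (r n) (c p)\<bar> < e/5"
        by (auto simp: eventually_sequentially intro!: exI[of _ k])
    qed
    then have "\<forall>\<^sub>F k in sequentially. \<forall>p\<in>P. \<forall>m\<ge>k. \<forall>n\<ge>k. \<bar>F (r m) (c p) - F (r n) (c p)\<bar> < e/5"
      using P(1) by (simp add: eventually_ball_finite_distrib)
    then obtain k where k: "\<And>p m n. p \<in> P \<Longrightarrow> m \<ge> k \<Longrightarrow> n \<ge> k \<Longrightarrow>
        \<bar>F (r m) (c p) - F (r n) (c p)\<bar> < e/5"
      unfolding eventually_sequentially by blast
    show ?thesis
    proof (intro exI[of _ k] allI impI ballI)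
      fix m n x assume mn: "m \<ge> k" "n \<ge> k" and x: "x \<in> topspace X"
      obtain p where p: "p \<in> P" "x \<in> N p" using P(3) x by blast
      then have pX: "p \<in> topspace X" using P(2) by auto
      have "\<bar>F i x - F i p\<bar> < e/5" "\<bar>F i (c p) - F i p\<bar> < e/5" for i
        using N[OF pX] p c[OF p(1)] by auto
      from this[of "r m"] this[of "r n"] k[OF p(1) mn]
      show "\<bar>F (r m) x - F (r n) x\<bar> < e" by linarith
    qed
  qed
  define h where "h = (\<lambda>x. lim (\<lambda>n. F (r n) x))"
  have lim: "(\<lambda>n. F (r n) x) \<longlonglongrightarrow> h x" if "x \<in> topspace X" for x
  proof -
    have "Cauchy (\<lambda>n. F (r n) x)"
      unfolding Cauchy_def dist_real_def using cauchy that by meson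
    then show ?thesis by (simp add: h_def Cauchy_convergent_iff convergent_LIMSEQ_iff)
  qed
  have unif: "\<exists>N. \<forall>n\<ge>N. \<forall>x\<in>topspace X. \<bar>F (r n) x - h x\<bar> < e" if "e > 0" for e
  proof -
    obtain N where N: "\<And>m n x. m \<ge> N \<Longrightarrow> n \<ge> N \<Longrightarrow> x \<in> topspace X \<Longrightarrow> \<bar>F (r m) x - F (r n) x\<bar> < e/2"
      using cauchy[of "e/2"] \<open>e > 0\<close> by auto
    show ?thesis
    proof (intro exI[of _ N] allI impI ballI)
      fix n x assume n: "n \<ge> N" and x: "x \<in> topspace X"
      have "(\<lambda>m. \<bar>F (r n) x - F (r m) x\<bar>) \<longlonglongrightarrow> \<bar>F (r n) x - h x\<bar>"
        by (intro tendsto_intros lim x)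
      moreover have "\<forall>\<^sub>F m in sequentially. \<bar>F (r n) x - F (r m) x\<bar> \<le> e/2"
        using N[OF n _ x] by (auto simp: eventually_sequentially intro!: exI[of _ N] less_imp_le)
      ultimately have "\<bar>F (r n) x - h x\<bar> \<le> e/2"
        by (rule tendsto_upperbound) simp
      then show "\<bar>F (r n) x - h x\<bar> < e" using \<open>e > 0\<close> by simp
    qed
  qed
  have "continuous_map X euclideanreal h"
  proof (rule continuous_map_realI)
    fix x and e :: real assume x: "x \<in> topspace X" and "e > 0"
    then obtain U where U: "openin X U" "x \<in> U" "\<forall>n. \<forall>y\<in>U. \<bar>F n y - F n x\<bar> < e/3"
      using eq[of x "e/3"] by auto
    obtain N where N: "\<forall>n\<ge>N. \<forall>x\<in>topspace X. \<bar>F (r n) x - h x\<bar> < e/3"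
      using unif[of "e/3"] \<open>e > 0\<close> by auto
    have "\<bar>h y - h x\<bar> < e" if "y \<in> U" for y
    proof -
      have "y \<in> topspace X" using U(1) that openin_subset by blast
      then have "\<bar>F (r N) y - h y\<bar> < e/3" "\<bar>F (r N) x - h x\<bar> < e/3" "\<bar>F (r N) y - F (r N) x\<bar> < e/3"
        using N U(3) x that by auto
      then show ?thesis by linarith
    qed
    then show "\<exists>U. openin X U \<and> x \<in> U \<and> (\<forall>y\<in>U. \<bar>h y - h x\<bar> < e)"
      using U by blast
  qed
  from r this unif show thesis by (rule that)
qed

section \<open>Shrinking open sets along a binary tree\<close>

lemma separate_values:
  fixes f g :: "'x \<Rightarrow> real"
  assumes "continuous_map X euclideanreal f" "continuous_map X euclideanreal g"
    and "openin X V" "openin X W" "a \<in> V" "b \<in> W" "f a \<noteq> g b"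
  shows "\<exists>V' W'. openin X V' \<and> V' \<noteq> {} \<and> V' \<subseteq> V \<and> openin X W' \<and> W' \<noteq> {} \<and> W' \<subseteq> W \<and>
           (\<forall>x\<in>V'. \<forall>y\<in>W'. f x \<noteq> g y)"
proof -
  obtain A B where AB: "open A" "open B" "f a \<in> A" "g b \<in> B" "A \<inter> B = {}"
    using hausdorff[OF assms(7)] by (elim exE conjE) (rule that)
  let ?V = "V \<inter> {x \<in> topspace X. f x \<in> A}" and ?W = "W \<inter> {x \<in> topspace X. g x \<in> B}"
  have "openin X ?V" "openin X ?W"
    using AB(1,2) by (auto intro!: openin_Int assms(3,4) openin_continuous_map_preimage[OF assms(1)]
        openin_continuous_map_preimage[OF assms(2)])
  moreover have "a \<in> ?V" "b \<in> ?W"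
    using assms(3-6) AB(3,4) openin_subset by blast+
  moreover have "\<forall>x\<in>?V. \<forall>y\<in>?W. f x \<noteq> g y" using AB(5) by auto
  ultimately show ?thesis by (intro exI[of _ ?V] exI[of _ ?W]) blast
qed

text \<open>The demands are met one after another; shrinking sets further cannot destroy a demand
  already met. Since the two indices of a demand differ, the two updates of \<open>U'\<close> do not
  collide.\<close>

lemma shrink_finitely_many_pairs:
  fixes U :: "'i \<Rightarrow> 'x set" and P :: "nat \<Rightarrow> 'x \<Rightarrow> 'x \<Rightarrow> bool"
  assumes P: "\<And>j V W. openin X V \<Longrightarrow> V \<noteq> {} \<Longrightarrow> openin X W \<Longrightarrow> W \<noteq> {} \<Longrightarrow>
      \<exists>V' W'. openin X V' \<and> V' \<noteq> {} \<and> V' \<subseteq> V \<and> openin X W' \<and> W' \<noteq> {} \<and> W' \<subseteq> W \<and>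
        (\<forall>x\<in>V'. \<forall>y\<in>W'. P j x y)"
    and Q: "finite Q" "\<And>i i' j. (i, i', j) \<in> Q \<Longrightarrow> i \<in> I \<and> i' \<in> I \<and> i \<noteq> i'"
    and U: "\<And>i. i \<in> I \<Longrightarrow> openin X (U i) \<and> U i \<noteq> {}"
  shows "\<exists>U'. (\<forall>i\<in>I. openin X (U' i) \<and> U' i \<noteq> {} \<and> U' i \<subseteq> U i) \<and>
     (\<forall>(i, i', j)\<in>Q. \<forall>x\<in>U' i. \<forall>y\<in>U' i'. P j x y)"
  using Q
proof (induction Q)
  case empty
  then show ?case using U by (intro exI[of _ U]) auto
next
  case (insert q Q)
  have "\<exists>U'. (\<forall>i\<in>I. openin X (U' i) \<and> U' i \<noteq> {} \<and> U' i \<subseteq> U i) \<and>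
     (\<forall>(i, i', j)\<in>Q. \<forall>x\<in>U' i. \<forall>y\<in>U' i'. P j x y)"
    by (rule insert.IH) (rule insert.prems, erule insertI2)
  then obtain U' where U'1: "\<forall>i\<in>I. openin X (U' i) \<and> U' i \<noteq> {} \<and> U' i \<subseteq> U i"
    and U'2: "\<forall>(i, i', j)\<in>Q. \<forall>x\<in>U' i. \<forall>y\<in>U' i'. P j x y"
    by (elim exE conjE) (rule that)
  note U' = U'1[rule_format] U'2[THEN bspec, simplified split, rule_format]
  obtain a a' j where q: "q = (a, a', j)" by (cases q) auto
  then have a: "a \<in> I" "a' \<in> I" "a \<noteq> a'" using insert.prems by auto
  obtain V W where VW: "openin X V" "V \<noteq> {}" "V \<subseteq> U' a" "openin X W" "W \<noteq> {}" "W \<subseteq> U' a'"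
    "\<forall>x\<in>V. \<forall>y\<in>W. P j x y"
    using P[of "U' a" "U' a'" j] U'(1)[OF a(1)] U'(1)[OF a(2)] by auto
  define U'' where "U'' = U'(a := V, a' := W)"
  have sub: "U'' i \<subseteq> U' i" for i
    using VW by (auto simp: U''_def)
  have "\<forall>i\<in>I. openin X (U'' i) \<and> U'' i \<noteq> {} \<and> U'' i \<subseteq> U i"
    using U'(1) VW a by (auto simp: U''_def)
  moreover have "P j x y" if "x \<in> U'' a" "y \<in> U'' a'" for x y
    using that VW(7) a(3) by (auto simp: U''_def)
  moreover have "P l x y" if "(i, i', l) \<in> Q" "x \<in> U'' i" "y \<in> U'' i'" for i i' l x y
    using U'(2)[OF that(1)] that(2,3) sub by blast
  ultimately show ?case
    by (intro exI[of _ U'']) (auto simp: q)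
qed

text \<open>A Cantor scheme of nonempty open sets indexed by bit strings, with nested closures. At
  length \<open>Suc n\<close> all pairs of different strings satisfy the demands up to
  \<open>n\<close>. Two different branches have different prefixes from some length on, so every
  demand is eventually imposed on them.\<close>

theorem Mycielski:
  fixes X :: "'x topology" and P :: "nat \<Rightarrow> 'x \<Rightarrow> 'x \<Rightarrow> bool"
  assumes X: "compact_space X" "Hausdorff_space X" "topspace X \<noteq> {}"
    and P: "\<And>j V W. openin X V \<Longrightarrow> V \<noteq> {} \<Longrightarrow> openin X W \<Longrightarrow> W \<noteq> {} \<Longrightarrow>
      \<exists>V' W'. openin X V' \<and> V' \<noteq> {} \<and> V' \<subseteq> V \<and> openin X W' \<and> W' \<noteq> {} \<and> W' \<subseteq> W \<and>
        (\<forall>x\<in>V'. \<forall>y\<in>W'. P j x y)"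
  shows "\<exists>\<phi> :: (nat \<Rightarrow> bool) \<Rightarrow> 'x. (\<forall>\<tau>. \<phi> \<tau> \<in> topspace X) \<and>
    (\<forall>\<tau> \<tau>' j. \<tau> \<noteq> \<tau>' \<longrightarrow> P j (\<phi> \<tau>) (\<phi> \<tau>'))"
proof -
  \<comment> \<open>Nesting closures inside the previous open sets ensures that the point found by
    compactness lies in the open sets themselves, where the demands hold.\<close>
  have regular: "\<exists>V. openin X V \<and> V \<noteq> {} \<and> X closure_of V \<subseteq> U" if U: "openin X U" "U \<noteq> {}" for U
  proof -
    obtain x where "x \<in> U" using U by blast
    have "\<forall>W x. openin X W \<and> x \<in> W \<longrightarrow>
        (\<exists>U V. openin X U \<and> closedin X V \<and> x \<in> U \<and> U \<subseteq> V \<and> V \<subseteq> W)"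
      using compact_Hausdorff_imp_regular_space[OF X(1,2)]
      unfolding neighbourhood_base_of_closedin[symmetric] neighbourhood_base_of .
    then obtain V C where "openin X V" "closedin X C" "x \<in> V" "V \<subseteq> C" "C \<subseteq> U"
      using U(1) \<open>x \<in> U\<close> by meson
    then show ?thesis
      using closure_of_minimal[of V C X] by blast
  qed
  define good where "good = (\<lambda>n (U :: bool list \<Rightarrow> 'x set). \<forall>\<sigma>. length \<sigma> = n \<longrightarrow> openin X (U \<sigma>) \<and> U \<sigma> \<noteq> {})"
  define step where "step = (\<lambda>n (U :: bool list \<Rightarrow> 'x set) U'.
     (\<forall>\<sigma>. length \<sigma> = Suc n \<longrightarrow> X closure_of (U' \<sigma>) \<subseteq> U (butlast \<sigma>)) \<and>
     (\<forall>\<sigma> \<sigma>' j. length \<sigma> = Suc n \<and> length \<sigma>' = Suc n \<and> \<sigma> \<noteq> \<sigma>' \<and> j \<le> n \<longrightarrow>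
        (\<forall>x\<in>U' \<sigma>. \<forall>y\<in>U' \<sigma>'. P j x y)))"
  have ex_step: "\<exists>U'. good (Suc n) U' \<and> step n U U'" if U: "good n U" for n U
  proof -
    define I where "I = {\<sigma> :: bool list. length \<sigma> = Suc n}"
    have finI: "finite I"
      using finite_lists_length_eq[of "UNIV :: bool set" "Suc n"] by (simp add: I_def)
    have "\<exists>V. openin X V \<and> V \<noteq> {} \<and> X closure_of V \<subseteq> U (butlast \<sigma>)" if "\<sigma> \<in> I" for \<sigma>
      using regular[of "U (butlast \<sigma>)"] U that by (simp add: good_def I_def)
    then obtain V where V: "\<And>\<sigma>. \<sigma> \<in> I \<Longrightarrow>
        openin X (V \<sigma>) \<and> V \<sigma> \<noteq> {} \<and> X closure_of (V \<sigma>) \<subseteq> U (butlast \<sigma>)"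
      by metis
    define Q where "Q = {(\<sigma>, \<sigma>', j). \<sigma> \<in> I \<and> \<sigma>' \<in> I \<and> \<sigma> \<noteq> \<sigma>' \<and> j \<le> n}"
    have "Q \<subseteq> I \<times> I \<times> {..n}" by (auto simp: Q_def)
    then have "finite Q" using finI by (meson finite_SigmaI finite_atMost finite_subset)
    then have "\<exists>U'. (\<forall>\<sigma>\<in>I. openin X (U' \<sigma>) \<and> U' \<sigma> \<noteq> {} \<and> U' \<sigma> \<subseteq> V \<sigma>) \<and>
       (\<forall>(\<sigma>, \<sigma>', j)\<in>Q. \<forall>x\<in>U' \<sigma>. \<forall>y\<in>U' \<sigma>'. P j x y)"
      by (intro shrink_finitely_many_pairs[OF P]) (use V in \<open>auto simp: Q_def\<close>)
    then obtain U' where U'1: "\<forall>\<sigma>\<in>I. openin X (U' \<sigma>) \<and> U' \<sigma> \<noteq> {} \<and> U' \<sigma> \<subseteq> V \<sigma>"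
      and U'2: "\<forall>(\<sigma>, \<sigma>', j)\<in>Q. \<forall>x\<in>U' \<sigma>. \<forall>y\<in>U' \<sigma>'. P j x y"
      by (elim exE conjE) (rule that)
    note U' = U'1[rule_format] U'2[THEN bspec, simplified split, rule_format]
    have "X closure_of (U' \<sigma>) \<subseteq> U (butlast \<sigma>)" if "\<sigma> \<in> I" for \<sigma>
      using closure_of_mono[of "U' \<sigma>" "V \<sigma>" X] U'(1)[OF that] V[OF that] by blast
    then have "good (Suc n) U' \<and> step n U U'"
      using U' by (auto simp: good_def step_def I_def Q_def)
    then show ?thesis by blast
  qed
  have "good 0 (\<lambda>_. topspace X)" using X(3) by (simp add: good_def)
  then obtain U where U: "\<And>n. good n (U n)" "\<And>n. step n (U n) (U (Suc n))"
    using dependent_nat_choice[of good step] ex_step by metis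
  define pre where "pre = (\<lambda>(\<tau> :: nat \<Rightarrow> bool) n. map \<tau> [0..<n])"
  have pre_len: "length (pre \<tau> n) = n" for \<tau> n by (simp add: pre_def)
  have pre_but: "butlast (pre \<tau> (Suc n)) = pre \<tau> n" for \<tau> n by (simp add: pre_def butlast_append)
  have nest: "X closure_of (U (Suc n) (pre \<tau> (Suc n))) \<subseteq> U n (pre \<tau> n)" for n \<tau>
    using U(2)[of n] pre_len[of \<tau> "Suc n"] pre_but unfolding step_def by metis
  have opn: "openin X (U n (pre \<tau> n))" "U n (pre \<tau> n) \<noteq> {}" for n \<tau>
    using U(1)[of n] pre_len[of \<tau> n] unfolding good_def by auto
  have "\<exists>x. \<forall>n. x \<in> U n (pre \<tau> n)" for \<tau>
  proof -
    let ?C = "\<lambda>n. X closure_of (U n (pre \<tau> n))"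
    have sub: "U n (pre \<tau> n) \<subseteq> ?C n" for n
      using closure_of_subset openin_subset opn(1) by metis
    have "(\<Inter>n. ?C n) \<noteq> {}"
    proof (rule compact_space_imp_nest[OF X(1)])
      show "closedin X (?C n)" for n by simp
      show "?C n \<noteq> {}" for n using sub opn(2) by blast
      show "decseq ?C"
        using nest sub by (intro decseq_SucI) blast
    qed
    then obtain x where "\<And>n. x \<in> ?C n" by auto
    then show ?thesis using nest by blast
  qed
  then obtain \<phi> where \<phi>: "\<And>\<tau> n. \<phi> \<tau> \<in> U n (pre \<tau> n)" by metis
  show ?thesis
  proof (intro exI[of _ \<phi>] conjI allI impI)
    show "\<phi> \<tau> \<in> topspace X" for \<tau>
      using \<phi>[of \<tau> 0] opn(1) openin_subset by blast
    fix \<tau> \<tau>' :: "nat \<Rightarrow> bool" and j assume "\<tau> \<noteq> \<tau>'"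
    then obtain i where i: "\<tau> i \<noteq> \<tau>' i" by auto
    \<comment> \<open>Prefixes of length \<open>Suc n\<close> must show the differing bit
      \<open>i\<close>, and level \<open>Suc n\<close> must already treat demand
      \<open>j\<close>.\<close>
    define n where "n = max i j"
    have "pre \<tau> (Suc n) ! i \<noteq> pre \<tau>' (Suc n) ! i"
      using i by (simp add: pre_def n_def less_Suc_eq_le del: upt_Suc)
    then have "pre \<tau> (Suc n) \<noteq> pre \<tau>' (Suc n)" by metis
    moreover have "j \<le> n" by (simp add: n_def)
    ultimately show "P j (\<phi> \<tau>) (\<phi> \<tau>')"
      using U(2)[of n] pre_len \<phi>[of \<tau> "Suc n"] \<phi>[of \<tau>' "Suc n"] unfolding step_def by metis
  qed
qed

section \<open>The invariant mean on a compact group\<close>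

text \<open>Lists rather than sets, because composing two averages produces products that may
  coincide and must be counted with multiplicity.\<close>

definition avg :: "'b list \<Rightarrow> ('b \<Rightarrow> real) \<Rightarrow> real" where
  "avg L g = (\<Sum>a\<leftarrow>L. g a) / real (length L)"

lemma avg_const: "L \<noteq> [] \<Longrightarrow> avg L (\<lambda>a. c) = c"
  by (simp add: avg_def sum_list_triv)

lemma avg_cong: "(\<And>a. a \<in> set L \<Longrightarrow> g a = h a) \<Longrightarrow> avg L g = avg L h"
  unfolding avg_def by (metis map_cong)

lemma avg_add: "avg L (\<lambda>a. g a + h a) = avg L g + avg L h"
  by (simp add: avg_def sum_list_addf add_divide_distrib)

lemma avg_cmul: "avg L (\<lambda>a. c * g a) = c * avg L g"
  by (simp add: avg_def sum_list_const_mult)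

lemma avg_mono: "(\<And>a. a \<in> set L \<Longrightarrow> g a \<le> h a) \<Longrightarrow> avg L g \<le> avg L h"
  unfolding avg_def by (intro divide_right_mono sum_list_mono) auto

lemma avg_close:
  assumes "L \<noteq> []" "\<And>a. a \<in> set L \<Longrightarrow> \<bar>g a - c\<bar> \<le> e"
  shows "\<bar>avg L g - c\<bar> \<le> e"
proof -
  have "avg L g \<le> avg L (\<lambda>a. c + e)" "avg L (\<lambda>a. c - e) \<le> avg L g"
    by (rule avg_mono, use assms(2) in force)+
  then show ?thesis by (simp add: avg_const[OF assms(1)])
qed

lemma avg_close2:
  assumes "L \<noteq> []" "\<And>a. a \<in> set L \<Longrightarrow> \<bar>g a - h a\<bar> \<le> e"
  shows "\<bar>avg L g - avg L h\<bar> \<le> e"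
proof -
  have "avg L g = avg L (\<lambda>a. g a - h a) + avg L h"
    by (simp flip: avg_add)
  then show ?thesis
    using avg_close[OF assms(1), of "\<lambda>a. g a - h a" 0 e] assms(2) by simp
qed

lemma sum_list_divide_distrib: "(\<Sum>x\<leftarrow>xs. h x / c) = (\<Sum>x\<leftarrow>xs. h x) / (c :: real)"
  by (induction xs) (simp_all add: add_divide_distrib)

lemma avg_swap: "avg A (\<lambda>a. avg B (\<lambda>b. g a b)) = avg B (\<lambda>b. avg A (\<lambda>a. g a b))"
proof -
  have "(\<Sum>a\<leftarrow>A. \<Sum>b\<leftarrow>B. g a b) = (\<Sum>b\<leftarrow>B. \<Sum>a\<leftarrow>A. g a b)"
    by (induction A) (simp_all add: sum_list_addf)
  then show ?thesis
    by (simp add: avg_def sum_list_divide_distrib)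
qed

text \<open>A single value that is low by \<open>d\<close> lowers the bound of the whole average by
  \<open>d / real (length L)\<close>. This gain drives both the existence of the mean and its strict
  positivity.\<close>

lemma avg_le_strict:
  assumes "\<And>a. a \<in> set L \<Longrightarrow> g a \<le> c" "b \<in> set L" "g b \<le> c - d"
  shows "avg L g \<le> c - d / real (length L)"
proof -
  have "(\<Sum>a\<leftarrow>L. g a) \<le> real (length L) * c - d"
    using assms
  proof (induction L)
    case (Cons a L)
    have tail: "(\<Sum>a\<leftarrow>L. g a) \<le> real (length L) * c"
      using sum_list_mono[of L g "\<lambda>_. c"] Cons.prems(1) by (simp add: sum_list_triv)
    show ?case
    proof (cases "b = a")
      case True
      then show ?thesis using tail Cons.prems by (simp add: algebra_simps)
    next
      case False
      then have "(\<Sum>a\<leftarrow>L. g a) \<le> real (length L) * c - d" using Cons by auto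
      moreover have "g a \<le> c" using Cons.prems by simp
      ultimately show ?thesis by (simp add: algebra_simps)
    qed
  qed simp
  then have "avg L g \<le> (real (length L) * c - d) / real (length L)"
    unfolding avg_def by (rule divide_right_mono) simp
  also have "\<dots> = c - d / real (length L)"
    using assms(2) by (cases L) (auto simp: diff_divide_distrib)
  finally show ?thesis .
qed

section \<open>Continuous functions and averages of left translates\<close>

context topological_group
begin

abbreviation CR :: "('a \<Rightarrow> real) \<Rightarrow> bool" where
  "CR \<equiv> continuous_map T euclideanreal"

abbreviation CR2 :: "('a \<Rightarrow> 'a \<Rightarrow> real) \<Rightarrow> bool" where
  "CR2 F \<equiv> continuous_map (prod_topology T T) euclideanreal (\<lambda>p. F (fst p) (snd p))"

lemma continuous_map_mult:
  assumes "continuous_map X T f" "continuous_map X T g"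
  shows "continuous_map X T (\<lambda>x. f x \<otimes> g x)"
proof -
  have "continuous_map X T ((\<lambda>(x, y). x \<otimes> y) \<circ> (\<lambda>x. (f x, g x)))"
    by (rule continuous_map_compose[OF _ continuous_mult]) (use assms in \<open>simp add: continuous_map_pairedI\<close>)
  then show ?thesis by (simp add: o_def)
qed

lemma continuous_map_inv:
  assumes "continuous_map X T f"
  shows "continuous_map X T (\<lambda>x. inv f x)"
  using continuous_map_compose[OF assms continuous_inv] by (simp add: o_def)

lemma continuous_map_const_carrier: "a \<in> carrier G \<Longrightarrow> continuous_map X T (\<lambda>x. a)"
  by (simp add: topspace_eq_carrier)

lemma continuous_map_real_comp:
  "CR f \<Longrightarrow> continuous_map X T g \<Longrightarrow> continuous_map X euclideanreal (\<lambda>x. f (g x))"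
  using continuous_map_compose[of X T g euclideanreal f] by (simp add: o_def)

lemmas group_cont = continuous_map_mult continuous_map_inv continuous_map_const_carrier
  continuous_map_id[unfolded id_def] continuous_map_fst continuous_map_snd

lemma CR_left: "CR f \<Longrightarrow> a \<in> carrier G \<Longrightarrow> CR (\<lambda>x. f (a \<otimes> x))"
  by (rule continuous_map_real_comp, assumption) (intro group_cont)

lemma CR2_sect1: "CR2 F \<Longrightarrow> x \<in> carrier G \<Longrightarrow> CR (\<lambda>y. F x y)"
  using continuous_map_compose[of T "prod_topology T T" "\<lambda>y. (x, y)" euclideanreal "\<lambda>p. F (fst p) (snd p)"]
  by (simp add: o_def continuous_map_pairedI topspace_eq_carrier)

lemma CR2_swap: "CR2 F \<Longrightarrow> CR2 (\<lambda>x y. F y x)"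
  using continuous_map_compose[of "prod_topology T T" "prod_topology T T" "\<lambda>p. (snd p, fst p)"
      euclideanreal "\<lambda>p. F (fst p) (snd p)"]
  by (simp add: o_def continuous_map_pairedI continuous_map_fst continuous_map_snd)

lemma CR2_sect2: "CR2 F \<Longrightarrow> y \<in> carrier G \<Longrightarrow> CR (\<lambda>x. F x y)"
  using CR2_sect1[OF CR2_swap] .

definition lavg :: "'a list \<Rightarrow> ('a \<Rightarrow> real) \<Rightarrow> 'a \<Rightarrow> real" where
  "lavg A f x = avg A (\<lambda>a. f (a \<otimes> x))"

definition carrier_list :: "'a list \<Rightarrow> bool" where
  "carrier_list A \<longleftrightarrow> A \<noteq> [] \<and> set A \<subseteq> carrier G"

text \<open>The order of the factors is that of \<open>f (a \<otimes> (b \<otimes> x))\<close>,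
  which arises from averaging over \<open>A\<close> first and over \<open>B\<close>
  afterwards.\<close>

definition list_prod :: "'a list \<Rightarrow> 'a list \<Rightarrow> 'a list" where
  "list_prod A B = concat (map (\<lambda>b. map (\<lambda>a. a \<otimes> b) A) B)"

lemma carrier_list_prod: "carrier_list A \<Longrightarrow> carrier_list B \<Longrightarrow> carrier_list (list_prod A B)"
  by (auto simp: carrier_list_def list_prod_def)

lemma avg_list_prod:
  "avg (list_prod A B) g = avg B (\<lambda>b. avg A (\<lambda>a. g (a \<otimes> b)))"
proof -
  have len: "length (list_prod A B) = length A * length B"
    by (induction B) (simp_all add: list_prod_def)
  have "(\<Sum>a\<leftarrow>list_prod A B. g a) = (\<Sum>b\<leftarrow>B. \<Sum>a\<leftarrow>A. g (a \<otimes> b))"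
    by (induction B) (simp_all add: list_prod_def o_def)
  then show ?thesis by (simp add: avg_def len sum_list_divide_distrib)
qed

lemma lavg_lavg:
  assumes "carrier_list A" "carrier_list B" "x \<in> carrier G"
  shows "lavg B (lavg A f) x = lavg (list_prod A B) f x"
  unfolding lavg_def avg_list_prod
  by (intro avg_cong) (use assms in \<open>auto simp: carrier_list_def subset_iff m_assoc\<close>)

lemma lavg_cong:
  assumes "carrier_list A" "x \<in> carrier G" "\<And>y. y \<in> carrier G \<Longrightarrow> f y = g y"
  shows "lavg A f x = lavg A g x"
  unfolding lavg_def by (intro avg_cong) (use assms in \<open>auto simp: carrier_list_def\<close>)

lemma lavg_close:
  assumes "carrier_list A" "x \<in> carrier G" "\<And>y. y \<in> carrier G \<Longrightarrow> \<bar>f y - c\<bar> \<le> e"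
  shows "\<bar>lavg A f x - c\<bar> \<le> e"
  unfolding lavg_def by (intro avg_close) (use assms in \<open>auto simp: carrier_list_def\<close>)

lemma CR_lavg:
  assumes "CR f" "carrier_list A"
  shows "CR (lavg A f)"
proof -
  have "CR (\<lambda>x. \<Sum>a\<leftarrow>A. f (a \<otimes> x))"
    using assms(2) unfolding carrier_list_def
  proof (induction A)
    case (Cons a A)
    then show ?case
      by (cases "A = []") (auto intro!: continuous_map_add CR_left assms(1))
  qed simp
  then have "CR (\<lambda>x. (1 / real (length A)) * (\<Sum>a\<leftarrow>A. f (a \<otimes> x)))"
    by (intro continuous_map_real_mult_left)
  then show ?thesis by (simp add: lavg_def[abs_def] avg_def)
qed

text \<open>This is von Neumann's mean: a constant that is a uniform limit of averages of left
  translates.\<close>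

definition is_mean :: "('a \<Rightarrow> real) \<Rightarrow> real \<Rightarrow> bool" where
  "is_mean f c \<longleftrightarrow> (\<forall>e>0. \<exists>A. carrier_list A \<and> (\<forall>x\<in>carrier G. \<bar>lavg A f x - c\<bar> < e))"

definition mean :: "('a \<Rightarrow> real) \<Rightarrow> real" where
  "mean f = (THE c. is_mean f c)"

end

section \<open>The mean: existence, uniqueness, positivity and exchange of two means\<close>

locale compact_separable_group = topological_group +
  assumes compact: "compact_space T"
    and separable: "separable_space T"
begin

text \<open>Multiplication by \<open>x0 \<otimes> inv x\<close> carries \<open>x\<close> to
  \<open>x0\<close>, so the preimages of \<open>U\<close> under such translations cover the group,
  and finitely many suffice. Information near one point thereby reaches every point.\<close>

lemma translates_cover:
  assumes "openin T U" "x0 \<in> U"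
  obtains B where "carrier_list B" "\<And>y. y \<in> carrier G \<Longrightarrow> \<exists>b\<in>set B. b \<otimes> y \<in> U"
proof -
  have x0: "x0 \<in> carrier G"
    using assms openin_subset topspace_eq_carrier by blast
  define N where "N = (\<lambda>x. {y \<in> topspace T. (x0 \<otimes> inv x) \<otimes> y \<in> U})"
  have "openin T (N x) \<and> x \<in> N x" if "x \<in> topspace T" for x
  proof
    have "continuous_map T T (\<lambda>y. (x0 \<otimes> inv x) \<otimes> y)"
      by (intro group_cont) (use x0 that in \<open>auto simp: topspace_eq_carrier\<close>)
    then show "openin T (N x)"
      unfolding N_def using assms(1) by (rule openin_continuous_map_preimage)
    show "x \<in> N x"
      using that x0 assms(2) by (simp add: N_def topspace_eq_carrier m_assoc)
  qed
  then obtain F where F: "finite F" "F \<subseteq> topspace T" "\<And>y. y \<in> topspace T \<Longrightarrow> \<exists>x\<in>F. y \<in> N x"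
    using compact_space_finite_subcover[OF compact] by metis
  obtain L where L: "set L = F" using F(1) finite_list by blast
  let ?B = "map (\<lambda>x. x0 \<otimes> inv x) L"
  show thesis
  proof
    have "F \<noteq> {}" using F(3) x0 topspace_eq_carrier by blast
    then show "carrier_list ?B"
      using L F(2) x0 by (auto simp: carrier_list_def topspace_eq_carrier)
    show "\<exists>b\<in>set ?B. b \<otimes> y \<in> U" if "y \<in> carrier G" for y
      using F(3)[of y] that L by (auto simp: N_def topspace_eq_carrier)
  qed
qed

text \<open>
  The mean is the infimum \<open>p\<close> of the upper bounds of averages of left translates. A uniform limit
  \<open>h\<close> of averages whose upper bounds tend to \<open>p\<close> is constant, since otherwise averaging \<open>h\<close> once
  more would push its maximum below \<open>p\<close>.
\<close>

lemma ex_mean: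
  assumes f: "CR f"
  shows "\<exists>c. is_mean f c"
proof -
  obtain B where B: "B > 0" "\<And>x. x \<in> carrier G \<Longrightarrow> \<bar>f x\<bar> \<le> B"
    using compact_space_real_bounded[OF compact f] topspace_eq_carrier by metis
  have lB: "\<bar>lavg A f x\<bar> \<le> B" if "carrier_list A" "x \<in> carrier G" for A x
    using lavg_close[OF that, of f 0 B] B by simp
  define P where "P = {c. \<exists>A. carrier_list A \<and> (\<forall>x\<in>carrier G. lavg A f x \<le> c)}"
  define p where "p = Inf P"
  have "B \<in> P"
    unfolding P_def using lB[of "[\<one>]"]
    by (auto simp: carrier_list_def abs_le_iff intro!: exI[of _ "[\<one>]"])
  have bdd: "bdd_below P"
  proof (rule bdd_belowI)
    fix c assume "c \<in> P"
    then obtain A where "carrier_list A" "lavg A f \<one> \<le> c" unfolding P_def by auto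
    then show "- B \<le> c" using lB[of A \<one>] by auto
  qed
  have "\<exists>A. carrier_list A \<and> (\<forall>x\<in>carrier G. lavg A f x \<le> p + 1 / real (Suc n))" for n
  proof -
    have "p < p + 1 / real (Suc n)" by simp
    then obtain c where "c \<in> P" "c < p + 1 / real (Suc n)"
      unfolding p_def using cInf_less_iff[OF _ bdd] \<open>B \<in> P\<close> by (metis empty_iff)
    then show ?thesis unfolding P_def by force
  qed
  then obtain A where A: "\<And>n. carrier_list (A n)"
    "\<And>n x. x \<in> carrier G \<Longrightarrow> lavg (A n) f x \<le> p + 1 / real (Suc n)"
    by metis
  have "\<exists>U. openin T U \<and> x \<in> U \<and> (\<forall>n. \<forall>y\<in>U. \<bar>lavg (A n) f y - lavg (A n) f x\<bar> < e)"
    if x: "x \<in> topspace T" and "e > 0" for x e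
  proof -
    have "CR2 (\<lambda>a x. f (a \<otimes> x))"
      by (rule continuous_map_real_comp[OF f]) (intro group_cont)
    then obtain V where V: "openin T V" "x \<in> V"
      "\<And>a y. a \<in> topspace T \<Longrightarrow> y \<in> V \<Longrightarrow> \<bar>f (a \<otimes> y) - f (a \<otimes> x)\<bar> < e/2"
      using continuous_map_uniform_in_first[OF compact _ x, of "\<lambda>p. f (fst p \<otimes> snd p)" "e/2"]
        \<open>e > 0\<close> by auto
    have "\<bar>lavg (A n) f y - lavg (A n) f x\<bar> \<le> e/2" if "y \<in> V" for n y
      unfolding lavg_def
    proof (rule avg_close2)
      show "A n \<noteq> []" using A(1) carrier_list_def by blast
      fix a assume "a \<in> set (A n)"
      then have "a \<in> topspace T" using A(1) carrier_list_def topspace_eq_carrier by blast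
      then show "\<bar>f (a \<otimes> y) - f (a \<otimes> x)\<bar> \<le> e/2" using V(3) that by (simp add: less_imp_le)
    qed
    moreover have "e/2 < e" using \<open>e > 0\<close> by simp
    ultimately show ?thesis using V(1,2) by (meson order.strict_trans1)
  qed
  then obtain r h where r: "strict_mono (r :: nat \<Rightarrow> nat)" and h: "CR h"
    and unif: "\<And>e. e > 0 \<Longrightarrow> \<exists>N. \<forall>n\<ge>N. \<forall>x\<in>topspace T. \<bar>lavg (A (r n)) f x - h x\<bar> < e"
    using Arzela_Ascoli_separable[OF compact separable, of "\<lambda>n. lavg (A n) f" B] lB A(1)
      topspace_eq_carrier by metis
  have h_le: "h x \<le> p" if x: "x \<in> carrier G" for x
  proof (rule field_le_epsilon)
    fix e :: real assume "e > 0"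
    then obtain N where N: "\<And>n. n \<ge> N \<Longrightarrow> \<bar>lavg (A (r n)) f x - h x\<bar> < e/2"
      using unif[of "e/2"] x topspace_eq_carrier by auto
    obtain M where "inverse (real (Suc M)) < e/2"
      using reals_Archimedean[of "e/2"] \<open>e > 0\<close> by auto
    define n where "n = max N M"
    have "1 / real (Suc (r n)) \<le> 1 / real (Suc M)"
      using seq_suble[OF r, of n] by (intro divide_left_mono) (auto simp: n_def)
    then have "lavg (A (r n)) f x \<le> p + e/2"
      using A(2)[OF x, of "r n"] \<open>inverse (real (Suc M)) < e/2\<close> by (simp add: inverse_eq_divide)
    moreover have "\<bar>lavg (A (r n)) f x - h x\<bar> < e/2" by (rule N) (simp add: n_def)
    ultimately show "h x \<le> p + e" by linarith
  qed
  have h_eq: "h x0 = p" if x0: "x0 \<in> carrier G" for x0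
  proof (rule ccontr)
    assume "h x0 \<noteq> p"
    then have less: "h x0 < p" using h_le[OF x0] by simp
    define d where "d = (p - h x0) / 2"
    have d: "d > 0" "h x0 < p - d" using less by (auto simp: d_def field_simps)
    have "openin T {x \<in> topspace T. h x \<in> {..<p - d}}"
      by (rule openin_continuous_map_preimage[OF h]) simp
    then obtain L where L: "carrier_list L"
      and LU: "\<And>y. y \<in> carrier G \<Longrightarrow> \<exists>b\<in>set L. b \<otimes> y \<in> {x \<in> topspace T. h x \<in> {..<p - d}}"
      by (rule translates_cover[of _ x0]) (use d(2) x0 in \<open>auto simp: topspace_eq_carrier\<close>)
    define q where "q = d / real (length L)"
    have "q > 0" using d(1) L by (simp add: q_def carrier_list_def)
    have lh: "lavg L h y \<le> p - q" if y: "y \<in> carrier G" for y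
      unfolding lavg_def q_def
    proof -
      obtain b where "b \<in> set L" "h (b \<otimes> y) < p - d" using LU[OF y] by blast
      then show "avg L (\<lambda>a. h (a \<otimes> y)) \<le> p - d / real (length L)"
        using h_le L that by (intro avg_le_strict[of _ _ _ b]) (auto simp: carrier_list_def)
    qed
    \<comment> \<open>Replacing \<open>h\<close> by an actual average of \<open>f\<close> costs only
      half of the gain \<open>q\<close>, so a composite average of \<open>f\<close> still stays
      below \<open>p\<close>.\<close>
    obtain n where n: "\<And>x. x \<in> carrier G \<Longrightarrow> \<bar>lavg (A (r n)) f x - h x\<bar> < q/2"
      using unif[of "q/2"] \<open>q > 0\<close> topspace_eq_carrier by auto
    have "lavg (list_prod (A (r n)) L) f y \<le> p - q/2" if y: "y \<in> carrier G" for y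
    proof -
      have "\<bar>lavg L (lavg (A (r n)) f) y - lavg L h y\<bar> \<le> q/2"
        unfolding lavg_def[of L]
        by (intro avg_close2) (use L n y in \<open>auto simp: carrier_list_def less_imp_le\<close>)
      then show ?thesis
        using lavg_lavg[OF A(1) L y, of "r n" f] lh[OF y] by linarith
    qed
    then have "p - q/2 \<in> P"
      unfolding P_def using carrier_list_prod[OF A(1) L] by blast
    then have "p \<le> p - q/2" unfolding p_def using bdd by (rule cInf_lower)
    with \<open>q > 0\<close> show False by simp
  qed
  have "is_mean f p"
    unfolding is_mean_def
  proof (intro allI impI)
    fix e :: real assume "e > 0"
    then obtain N where "\<forall>x\<in>topspace T. \<bar>lavg (A (r N)) f x - h x\<bar> < e" using unif by blast
    then show "\<exists>A. carrier_list A \<and> (\<forall>x\<in>carrier G. \<bar>lavg A f x - p\<bar> < e)"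
      using A(1) h_eq topspace_eq_carrier by auto
  qed
  then show ?thesis by blast
qed

text \<open>Every left mean agrees with a right mean, because left and right averages commute.\<close>

lemma is_mean_unique:
  assumes f: "CR f" and "is_mean f c" "is_mean f c'"
  shows "c = c'"
proof -
  \<comment> \<open>Left averages of \<open>f\<close> composed with inversion are right averages of
    \<open>f\<close>: at \<open>inv a\<close> the translate by \<open>b\<close> has the value
    \<open>f (a \<otimes> inv b)\<close>.\<close>
  obtain d where d: "is_mean (\<lambda>x. f (inv x)) d"
    using ex_mean[of "\<lambda>x. f (inv x)"] by (metis continuous_map_real_comp[OF f continuous_inv])
  have "c = d" if c: "is_mean f c" for c
  proof -
    have "\<bar>c - d\<bar> \<le> 0 + e" if "e > 0" for e
    proof -
      obtain A where A: "carrier_list A" "\<And>x. x \<in> carrier G \<Longrightarrow> \<bar>lavg A f x - c\<bar> < e/2"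
        using c \<open>e > 0\<close> unfolding is_mean_def by (meson half_gt_zero)
      obtain B where B: "carrier_list B" "\<And>x. x \<in> carrier G \<Longrightarrow> \<bar>lavg B (\<lambda>x. f (inv x)) x - d\<bar> < e/2"
        using d \<open>e > 0\<close> unfolding is_mean_def by (meson half_gt_zero)
      let ?s = "avg B (\<lambda>b. avg A (\<lambda>a. f (a \<otimes> inv b)))"
      have "\<bar>?s - c\<bar> \<le> e/2"
      proof (rule avg_close)
        show "B \<noteq> []" using B(1) by (simp add: carrier_list_def)
        fix b assume "b \<in> set B"
        then have "inv b \<in> carrier G" using B(1) by (auto simp: carrier_list_def)
        then show "\<bar>avg A (\<lambda>a. f (a \<otimes> inv b)) - c\<bar> \<le> e/2"
          using A(2) unfolding lavg_def by (simp add: less_imp_le)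
      qed
      moreover have "\<bar>avg A (\<lambda>a. avg B (\<lambda>b. f (a \<otimes> inv b))) - d\<bar> \<le> e/2"
      proof (rule avg_close)
        show "A \<noteq> []" using A(1) by (simp add: carrier_list_def)
        fix a assume "a \<in> set A"
        then have a: "a \<in> carrier G" using A(1) by (auto simp: carrier_list_def)
        have "avg B (\<lambda>b. f (a \<otimes> inv b)) = lavg B (\<lambda>x. f (inv x)) (inv a)"
          unfolding lavg_def
          by (intro avg_cong) (use a B(1) in \<open>auto simp: carrier_list_def subset_iff inv_mult_group\<close>)
        then show "\<bar>avg B (\<lambda>b. f (a \<otimes> inv b)) - d\<bar> \<le> e/2"
          using B(2)[of "inv a"] a by simp
      qed
      ultimately show ?thesis using avg_swap[of B A "\<lambda>b a. f (a \<otimes> inv b)"] by linarith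
    qed
    then have "\<bar>c - d\<bar> \<le> 0" by (rule field_le_epsilon)
    then show ?thesis by simp
  qed
  with assms show ?thesis by metis
qed

lemma is_mean_mean: "CR f \<Longrightarrow> is_mean f (mean f)"
  unfolding mean_def by (metis ex_mean is_mean_unique theI_unique)

lemma mean_eqI: "CR f \<Longrightarrow> is_mean f c \<Longrightarrow> mean f = c"
  using is_mean_mean is_mean_unique by blast

text \<open>Averaging \<open>lavg A f\<close> over \<open>B\<close> is averaging \<open>f\<close>
  over \<open>list_prod A B\<close>, so any mean of the former is one of the latter.\<close>

lemma mean_lavg:
  assumes "CR f" "carrier_list A"
  shows "mean (lavg A f) = mean f"
proof -
  have "is_mean f (mean (lavg A f))"
    unfolding is_mean_def
  proof (intro allI impI)
    fix e :: real assume "e > 0"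
    then obtain B where "carrier_list B" "\<forall>x\<in>carrier G. \<bar>lavg B (lavg A f) x - mean (lavg A f)\<bar> < e"
      using is_mean_mean[OF CR_lavg[OF assms]] unfolding is_mean_def by blast
    then show "\<exists>B. carrier_list B \<and> (\<forall>x\<in>carrier G. \<bar>lavg B f x - mean (lavg A f)\<bar> < e)"
      using lavg_lavg[OF assms(2)] carrier_list_prod[OF assms(2)] by (metis (no_types, lifting))
  qed
  then show ?thesis using mean_eqI[OF assms(1)] by simp
qed

text \<open>The functions are treated in turn: averaging once more brings the new function near its
  mean and keeps the old ones near theirs. Additivity of the mean rests on having one list for
  several functions.\<close>

lemma simultaneous_mean:
  assumes "finite F" "\<And>f. f \<in> F \<Longrightarrow> CR f" "e > 0"
  obtains A where "carrier_list A"
    "\<And>f x. f \<in> F \<Longrightarrow> x \<in> carrier G \<Longrightarrow> \<bar>lavg A f x - mean f\<bar> < e"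
proof -
  have "\<exists>A. carrier_list A \<and> (\<forall>f\<in>F. \<forall>x\<in>carrier G. \<bar>lavg A f x - mean f\<bar> < e)"
    using assms(1,2)
  proof (induction F)
    case empty
    then show ?case by (intro exI[of _ "[\<one>]"]) (simp add: carrier_list_def)
  next
    case (insert f F)
    then obtain A where A: "carrier_list A" "\<And>f x. f \<in> F \<Longrightarrow> x \<in> carrier G \<Longrightarrow> \<bar>lavg A f x - mean f\<bar> < e"
      by auto
    have f: "CR f" using insert by simp
    obtain B where B: "carrier_list B" "\<forall>x\<in>carrier G. \<bar>lavg B (lavg A f) x - mean f\<bar> < e"
      using is_mean_mean[OF CR_lavg[OF f A(1)]] \<open>e > 0\<close> mean_lavg[OF f A(1)]
      unfolding is_mean_def by metis
    have "\<bar>lavg B (lavg A g) x - mean g\<bar> < e" if "g \<in> F" "x \<in> carrier G" for g x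
    proof -
      \<comment> \<open>Averaging preserves only weak bounds; the finite maximum \<open>m\<close>
        keeps the strict one.\<close>
      define m where "m = Max ((\<lambda>b. \<bar>lavg A g (b \<otimes> x) - mean g\<bar>) ` set B)"
      have ne: "set B \<noteq> {}" using B(1) by (auto simp: carrier_list_def)
      have "m < e"
        unfolding m_def using ne A(2)[OF that(1)] B(1) that(2)
        by (subst Max_less_iff) (auto simp: carrier_list_def)
      moreover have "\<bar>lavg B (lavg A g) x - mean g\<bar> \<le> m"
        unfolding lavg_def[of B]
        by (rule avg_close) (use ne in \<open>auto simp: m_def\<close>)
      ultimately show ?thesis by simp
    qed
    with B lavg_lavg[OF A(1) B(1)] carrier_list_prod[OF A(1) B(1)] show ?case
      by (intro exI[of _ "list_prod A B"]) auto
  qed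
  then show thesis using that by blast
qed

lemma mean_add:
  assumes "CR f" "CR g"
  shows "mean (\<lambda>x. f x + g x) = mean f + mean g"
proof -
  have fg: "CR (\<lambda>x. f x + g x)" using assms by (rule continuous_map_add)
  have "\<bar>mean (\<lambda>x. f x + g x) - (mean f + mean g)\<bar> \<le> 0 + e" if "e > 0" for e
  proof -
    obtain A where A: "carrier_list A"
      "\<And>h x. h \<in> {f, g, \<lambda>x. f x + g x} \<Longrightarrow> x \<in> carrier G \<Longrightarrow> \<bar>lavg A h x - mean h\<bar> < e/3"
      using simultaneous_mean[of "{f, g, \<lambda>x. f x + g x}" "e/3"] assms fg \<open>e > 0\<close> by auto
    have "lavg A (\<lambda>x. f x + g x) \<one> = lavg A f \<one> + lavg A g \<one>"
      by (simp add: lavg_def avg_add)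
    moreover have "\<bar>lavg A f \<one> - mean f\<bar> < e/3" "\<bar>lavg A g \<one> - mean g\<bar> < e/3"
      "\<bar>lavg A (\<lambda>x. f x + g x) \<one> - mean (\<lambda>x. f x + g x)\<bar> < e/3"
      by (intro A(2); simp)+
    ultimately show ?thesis by linarith
  qed
  then have "\<bar>mean (\<lambda>x. f x + g x) - (mean f + mean g)\<bar> \<le> 0" by (rule field_le_epsilon)
  then show ?thesis by simp
qed

lemma mean_cong:
  assumes "\<And>x. x \<in> carrier G \<Longrightarrow> f x = g x"
  shows "mean f = mean g"
proof -
  have "(\<forall>x\<in>carrier G. \<bar>lavg A f x - c\<bar> < e) \<longleftrightarrow> (\<forall>x\<in>carrier G. \<bar>lavg A g x - c\<bar> < e)"
    if "carrier_list A" for A c e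
    by (intro ball_cong) (simp_all add: lavg_cong[OF that _ assms])
  then have "is_mean f = is_mean g"
    unfolding is_mean_def by (simp cong: conj_cong)
  then show ?thesis by (simp add: mean_def)
qed

lemma mean_cmul:
  assumes "CR f"
  shows "mean (\<lambda>x. c * f x) = c * mean f"
proof (rule mean_eqI)
  show "CR (\<lambda>x. c * f x)" using assms by (rule continuous_map_real_mult_left)
  show "is_mean (\<lambda>x. c * f x) (c * mean f)"
    unfolding is_mean_def
  proof (intro allI impI)
    fix e :: real assume "e > 0"
    then have "e / (\<bar>c\<bar> + 1) > 0" by simp
    then obtain A where A: "carrier_list A" "\<forall>x\<in>carrier G. \<bar>lavg A f x - mean f\<bar> < e / (\<bar>c\<bar> + 1)"
      using is_mean_mean[OF assms] unfolding is_mean_def by blast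
    have "\<bar>lavg A (\<lambda>x. c * f x) x - c * mean f\<bar> < e" if "x \<in> carrier G" for x
    proof -
      have "\<bar>lavg A (\<lambda>x. c * f x) x - c * mean f\<bar> = \<bar>c\<bar> * \<bar>lavg A f x - mean f\<bar>"
        by (simp add: lavg_def avg_cmul flip: right_diff_distrib abs_mult)
      also have "\<dots> \<le> \<bar>c\<bar> * (e / (\<bar>c\<bar> + 1))"
        using A(2) that by (intro mult_left_mono) (auto simp: less_imp_le)
      also have "\<dots> < e" using \<open>e > 0\<close> by (simp add: field_simps)
      finally show ?thesis .
    qed
    with A(1) show "\<exists>A. carrier_list A \<and> (\<forall>x\<in>carrier G. \<bar>lavg A (\<lambda>x. c * f x) x - c * mean f\<bar> < e)"
      by blast
  qed
qed

lemma mean_const: "mean (\<lambda>x. c) = c"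
proof (rule mean_eqI)
  show "is_mean (\<lambda>x. c) c"
    unfolding is_mean_def
    by (auto intro!: exI[of _ "[\<one>]"] simp: carrier_list_def lavg_def avg_const)
qed simp

lemma mean_diff:
  assumes "CR f" "CR g"
  shows "mean (\<lambda>x. f x - g x) = mean f - mean g"
  using mean_add[OF assms(1) continuous_map_real_mult_left[OF assms(2), of "- 1"]]
    mean_cmul[OF assms(2), of "- 1"] by simp

lemma mean_sum:
  assumes "finite I" "\<And>i. i \<in> I \<Longrightarrow> CR (f i)"
  shows "mean (\<lambda>x. \<Sum>i\<in>I. f i x) = (\<Sum>i\<in>I. mean (f i))"
  using assms
proof (induction I)
  case empty
  then show ?case by (simp add: mean_const)
next
  case (insert i I)
  have "CR (\<lambda>x. \<Sum>i\<in>I. f i x)" using insert by (intro continuous_map_sum) auto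
  with insert show ?case by (simp add: mean_add)
qed

lemma mean_nonneg:
  assumes "CR f" "\<And>x. x \<in> carrier G \<Longrightarrow> f x \<ge> 0"
  shows "mean f \<ge> 0"
proof -
  have "0 \<le> mean f + e" if "e > 0" for e
  proof -
    obtain A where A: "carrier_list A" "\<forall>x\<in>carrier G. \<bar>lavg A f x - mean f\<bar> < e"
      using is_mean_mean[OF assms(1)] \<open>e > 0\<close> unfolding is_mean_def by blast
    have "avg A (\<lambda>a. 0) \<le> lavg A f \<one>"
      unfolding lavg_def by (intro avg_mono assms(2)) (use A(1) in \<open>auto simp: carrier_list_def\<close>)
    then have "0 \<le> lavg A f \<one>" by (simp add: avg_def)
    moreover have "\<bar>lavg A f \<one> - mean f\<bar> < e" using A(2) by blast
    ultimately show ?thesis by linarith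
  qed
  then show ?thesis by (rule field_le_epsilon)
qed

lemma mean_mono:
  assumes "CR f" "CR g" "\<And>x. x \<in> carrier G \<Longrightarrow> f x \<le> g x"
  shows "mean f \<le> mean g"
  using mean_nonneg[of "\<lambda>x. g x - f x"] mean_diff[OF assms(2,1)] assms
  by (simp add: continuous_map_diff)

lemma mean_close:
  assumes "CR f" "CR g" "\<And>x. x \<in> carrier G \<Longrightarrow> \<bar>f x - g x\<bar> \<le> e"
  shows "\<bar>mean f - mean g\<bar> \<le> e"
proof -
  have d: "CR (\<lambda>x. f x - g x)" using assms by (intro continuous_map_diff)
  have c: "CR (\<lambda>x. c)" for c :: real by simp
  have "mean (\<lambda>x. f x - g x) \<le> mean (\<lambda>x. e)" "mean (\<lambda>x. - e) \<le> mean (\<lambda>x. f x - g x)"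
    by (rule mean_mono[OF d c] mean_mono[OF c d], use assms(3) in fastforce)+
  then show ?thesis by (simp add: mean_diff assms mean_const abs_le_iff)
qed

lemma mean_left:
  assumes f: "CR f" and a: "a \<in> carrier G"
  shows "mean (\<lambda>x. f (a \<otimes> x)) = mean f"
proof -
  have "mean (lavg [a] f) = mean f"
    by (rule mean_lavg[OF f]) (simp add: carrier_list_def a)
  then show ?thesis by (simp add: lavg_def[abs_def] avg_def)
qed

text \<open>Finitely many translates of the open set where \<open>f\<close> exceeds \<open>d\<close>
  cover the group, so one average of \<open>f\<close> is bounded below by a positive
  constant.\<close>

lemma mean_pos:
  assumes f: "CR f" and nonneg: "\<And>x. x \<in> carrier G \<Longrightarrow> f x \<ge> 0"
    and x0: "x0 \<in> carrier G" "f x0 > 0"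
  shows "mean f > 0"
proof -
  define d where "d = f x0 / 2"
  have d: "d > 0" "f x0 > d" using x0 by (auto simp: d_def)
  have "openin T {x \<in> topspace T. f x \<in> {d<..}}"
    by (rule openin_continuous_map_preimage[OF f]) simp
  then obtain L where L: "carrier_list L"
    and LU: "\<And>y. y \<in> carrier G \<Longrightarrow> \<exists>b\<in>set L. b \<otimes> y \<in> {x \<in> topspace T. f x \<in> {d<..}}"
    by (rule translates_cover[of _ x0]) (use d(2) x0 in \<open>auto simp: topspace_eq_carrier\<close>)
  define q where "q = d / real (length L)"
  have "q > 0" using d(1) L by (simp add: q_def carrier_list_def)
  have "q \<le> lavg L f y" if y: "y \<in> carrier G" for y
  proof -
    obtain b where "b \<in> set L" "f (b \<otimes> y) > d" using LU[OF y] by blast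
    \<comment> \<open>\<open>avg_le_strict\<close> bounds averages from above, hence the change of
      sign and the bound 0.\<close>
    then have "avg L (\<lambda>a. (- 1) * f (a \<otimes> y)) \<le> 0 - d / real (length L)"
      using nonneg L that by (intro avg_le_strict[of _ _ _ b]) (auto simp: carrier_list_def)
    then show ?thesis unfolding avg_cmul lavg_def q_def by simp
  qed
  then have "mean (\<lambda>x. q) \<le> mean (lavg L f)"
    by (intro mean_mono CR_lavg f L) auto
  with \<open>q > 0\<close> show ?thesis by (simp add: mean_const mean_lavg f L)
qed

lemma CR_mean:
  assumes "CR2 F"
  shows "CR (\<lambda>x. mean (\<lambda>y. F x y))"
proof (rule continuous_map_realI)
  fix x and e :: real assume x: "x \<in> topspace T" and "e > 0"
  then obtain V where V: "openin T V" "x \<in> V"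
    "\<And>y x'. y \<in> topspace T \<Longrightarrow> x' \<in> V \<Longrightarrow> \<bar>F x' y - F x y\<bar> < e/2"
    using continuous_map_uniform_in_first[OF compact CR2_swap[OF assms] x, of "e/2"] by auto
  have "\<bar>mean (F x') - mean (F x)\<bar> < e" if "x' \<in> V" for x'
  proof -
    have "x' \<in> carrier G" using V(1) that openin_subset topspace_eq_carrier by blast
    then have "\<bar>mean (F x') - mean (F x)\<bar> \<le> e/2"
      using V(3)[OF _ that] x
      by (intro mean_close CR2_sect1[OF assms]) (auto simp: topspace_eq_carrier less_imp_le)
    then show ?thesis using \<open>e > 0\<close> by simp
  qed
  with V show "\<exists>U. openin T U \<and> x \<in> U \<and> (\<forall>y\<in>U. \<bar>mean (F y) - mean (F x)\<bar> < e)"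
    by blast
qed

text \<open>A Fubini theorem. By compactness the sections \<open>F x\<close> are uniformly close to
  finitely many of them, so one finite list approximates all inner means at once, and a finite
  average commutes with the mean.\<close>

lemma mean_swap:
  assumes F: "CR2 F"
  shows "mean (\<lambda>x. mean (\<lambda>y. F x y)) = mean (\<lambda>y. mean (\<lambda>x. F x y))"
proof -
  let ?N = "\<lambda>y. mean (\<lambda>x. F x y)"
  have N: "CR ?N" using CR_mean[OF CR2_swap[OF F]] by simp
  have "\<bar>mean (\<lambda>x. mean (\<lambda>y. F x y)) - mean ?N\<bar> \<le> 0 + e" if "e > 0" for e
  proof -
    \<comment> \<open>Three quarters compare \<open>avg A (F x)\<close> with
      \<open>mean (F x)\<close> by way of a nearby section \<open>F p\<close>; the last one is the
      error of the average of \<open>?N\<close>.\<close>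
    have e4: "e/4 > 0" using that by simp
    have "\<exists>V. openin T V \<and> x \<in> V \<and> (\<forall>y\<in>carrier G. \<forall>x'\<in>V. \<bar>F x' y - F x y\<bar> < e/4)"
      if x: "x \<in> topspace T" for x
    proof -
      obtain V where "openin T V" "x \<in> V"
        "\<And>y x'. y \<in> topspace T \<Longrightarrow> x' \<in> V \<Longrightarrow> \<bar>F x' y - F x y\<bar> < e/4"
        using continuous_map_uniform_in_first[OF compact CR2_swap[OF F] x e4] by auto
      then show ?thesis using topspace_eq_carrier by blast
    qed
    then obtain V where V: "\<And>x. x \<in> topspace T \<Longrightarrow> openin T (V x) \<and> x \<in> V x"
      "\<And>x y x'. x \<in> topspace T \<Longrightarrow> y \<in> carrier G \<Longrightarrow> x' \<in> V x \<Longrightarrow> \<bar>F x' y - F x y\<bar> < e/4"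
      by metis
    obtain P where P: "finite P" "P \<subseteq> topspace T" "\<And>y. y \<in> topspace T \<Longrightarrow> \<exists>x\<in>P. y \<in> V x"
      using compact_space_finite_subcover[OF compact V(1)] by metis
    have PG: "P \<subseteq> carrier G" using P(2) topspace_eq_carrier by simp
    obtain A where A: "carrier_list A" and
      AP: "\<And>f x. f \<in> insert ?N (F ` P) \<Longrightarrow> x \<in> carrier G \<Longrightarrow> \<bar>lavg A f x - mean f\<bar> < e/4"
      using simultaneous_mean[of "insert ?N (F ` P)" "e/4"] P(1) PG N CR2_sect1[OF F] e4 by auto
    have lavg1: "lavg A f \<one> = avg A f" for f
      unfolding lavg_def by (intro avg_cong) (use A in \<open>auto simp: carrier_list_def\<close>)
    have close: "\<bar>avg A (F x) - mean (F x)\<bar> \<le> 3 * e/4" if x: "x \<in> carrier G" for x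
    proof -
      obtain p where p: "p \<in> P" "x \<in> V p" using P(3) x topspace_eq_carrier by blast
      then have pG: "p \<in> carrier G" using PG by blast
      have c: "\<bar>F x y - F p y\<bar> \<le> e/4" if "y \<in> carrier G" for y
        using V(2)[of p y x] p that pG topspace_eq_carrier by (simp add: less_imp_le)
      have "\<bar>avg A (F x) - avg A (F p)\<bar> \<le> e/4"
        using c A by (intro avg_close2) (auto simp: carrier_list_def)
      moreover have "\<bar>mean (F x) - mean (F p)\<bar> \<le> e/4"
        by (intro mean_close CR2_sect1[OF F] x pG c)
      moreover have "\<bar>avg A (F p) - mean (F p)\<bar> < e/4"
        using AP[of "F p" \<one>] p lavg1 by simp
      ultimately show ?thesis by linarith
    qed
    have cs: "CR (\<lambda>x. F x a)" if "a \<in> carrier G" for a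
      using CR2_sect2[OF F that] .
    have "set A \<subseteq> carrier G" using A by (simp add: carrier_list_def)
    then have "CR (\<lambda>x. \<Sum>a\<leftarrow>A. F x a) \<and> mean (\<lambda>x. \<Sum>a\<leftarrow>A. F x a) = (\<Sum>a\<leftarrow>A. ?N a)"
    proof (induction A)
      case (Cons a A)
      then have "CR (\<lambda>x. \<Sum>a\<leftarrow>A. F x a)" "CR (\<lambda>x. F x a)" using cs by auto
      with Cons show ?case by (simp add: mean_add continuous_map_add)
    qed (simp add: mean_const)
    then have CA: "CR (\<lambda>x. avg A (F x))" and "mean (\<lambda>x. avg A (F x)) = avg A ?N"
      using mean_cmul[of "\<lambda>x. \<Sum>a\<leftarrow>A. F x a" "1 / real (length A)"]
        continuous_map_real_mult_left[of T "\<lambda>x. \<Sum>a\<leftarrow>A. F x a" "1 / real (length A)"]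
      by (simp_all add: avg_def)
    moreover have "\<bar>mean (\<lambda>x. avg A (F x)) - mean (\<lambda>x. mean (\<lambda>y. F x y))\<bar> \<le> 3 * e/4"
      by (intro mean_close CA CR_mean F close)
    moreover have "\<bar>avg A ?N - mean ?N\<bar> < e/4"
      using AP[of ?N \<one>] lavg1 by simp
    ultimately show ?thesis by linarith
  qed
  then have "\<bar>mean (\<lambda>x. mean (\<lambda>y. F x y)) - mean ?N\<bar> \<le> 0" by (rule field_le_epsilon)
  then show ?thesis by simp
qed

end

section \<open>Finite-dimensional representations\<close>

context topological_group
begin

text \<open>The matrix of \<open>\<one>\<close> is only known to be idempotent, so nontriviality is
  expressed by comparison with \<open>c i j \<one>\<close>, not with the identity matrix.\<close>

definition matrix_rep :: "nat \<Rightarrow> (nat \<Rightarrow> nat \<Rightarrow> 'a \<Rightarrow> real) \<Rightarrow> bool" where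
  "matrix_rep n c \<longleftrightarrow> (\<forall>i<n. \<forall>j<n. CR (c i j) \<and>
     (\<forall>x\<in>carrier G. \<forall>y\<in>carrier G. c i j (x \<otimes> y) = (\<Sum>k<n. c i k x * c k j y)))"

end

context compact_separable_group
begin

section \<open>The inner product given by the mean\<close>

definition ip :: "('a \<Rightarrow> real) \<Rightarrow> ('a \<Rightarrow> real) \<Rightarrow> real" where
  "ip f g = mean (\<lambda>x. f x * g x)"

lemma ip_sym: "ip f g = ip g f"
  by (simp add: ip_def mult.commute)

lemma ip_cong:
  "(\<And>x. x \<in> carrier G \<Longrightarrow> f x = f' x) \<Longrightarrow> (\<And>x. x \<in> carrier G \<Longrightarrow> g x = g' x) \<Longrightarrow> ip f g = ip f' g'"
  unfolding ip_def by (rule mean_cong) simp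

lemma ip_cmul: "CR f \<Longrightarrow> CR g \<Longrightarrow> ip (\<lambda>x. c * f x) g = c * ip f g"
  using mean_cmul[of "\<lambda>x. f x * g x" c] by (simp add: ip_def continuous_map_real_mult mult.assoc)

lemma ip_diff: "CR f \<Longrightarrow> CR g \<Longrightarrow> CR h \<Longrightarrow> ip (\<lambda>x. f x - g x) h = ip f h - ip g h"
  using mean_diff[of "\<lambda>x. f x * h x" "\<lambda>x. g x * h x"]
  by (simp add: ip_def continuous_map_real_mult left_diff_distrib)

lemma ip_sum:
  fixes n :: nat
  assumes "\<And>i. i < n \<Longrightarrow> CR (e i)" "CR g"
  shows "ip (\<lambda>x. \<Sum>i<n. c i * e i x) g = (\<Sum>i<n. c i * ip (e i) g)"
proof -
  have "ip (\<lambda>x. \<Sum>i<n. c i * e i x) g = mean (\<lambda>x. \<Sum>i<n. c i * (e i x * g x))"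
    by (simp add: ip_def sum_distrib_right mult.assoc)
  also have "\<dots> = (\<Sum>i<n. mean (\<lambda>x. c i * (e i x * g x)))"
    using assms by (intro mean_sum) (auto intro!: continuous_map_real_mult_left continuous_map_real_mult)
  also have "\<dots> = (\<Sum>i<n. c i * ip (e i) g)"
    using assms by (intro sum.cong) (auto simp: ip_def intro!: mean_cmul continuous_map_real_mult)
  finally show ?thesis .
qed

lemma ip_nonneg: "CR f \<Longrightarrow> ip f f \<ge> 0"
  unfolding ip_def by (rule mean_nonneg) (auto intro: continuous_map_real_mult)

lemma ip_eq_0: "CR f \<Longrightarrow> ip f f = 0 \<Longrightarrow> x \<in> carrier G \<Longrightarrow> f x = 0"
  using mean_pos[of "\<lambda>x. f x * f x" x] unfolding ip_def
  by (metis continuous_map_real_mult less_irrefl mult_eq_0_iff not_square_less_zero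
      linorder_neqE_linordered_idom zero_le_square)

lemma ip_le_square:
  assumes f: "CR f" and b: "\<And>x. x \<in> carrier G \<Longrightarrow> \<bar>f x\<bar> \<le> b"
  shows "ip f f \<le> b\<^sup>2"
proof -
  have "ip f f \<le> mean (\<lambda>x. b\<^sup>2)"
    unfolding ip_def
  proof (rule mean_mono)
    fix x assume "x \<in> carrier G"
    from power_mono[OF b[OF this] abs_ge_zero, of 2] show "f x * f x \<le> b\<^sup>2"
      by (simp add: power2_eq_square)
  qed (auto intro: continuous_map_real_mult f)
  then show ?thesis by (simp add: mean_const)
qed

lemma ip_square_diff:
  assumes f: "CR f" and g: "CR g"
  shows "ip (\<lambda>x. f x - c * g x) (\<lambda>x. f x - c * g x) = ip f f - 2 * c * ip f g + c\<^sup>2 * ip g g"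
proof -
  have cg: "CR (\<lambda>x. c * g x)" by (intro continuous_map_real_mult_left g)
  have d: "CR (\<lambda>x. f x - c * g x)" by (intro continuous_map_diff f cg)
  have "ip (\<lambda>x. f x - c * g x) (\<lambda>x. f x - c * g x)
      = ip f (\<lambda>x. f x - c * g x) - ip (\<lambda>x. c * g x) (\<lambda>x. f x - c * g x)"
    by (rule ip_diff[OF f cg d])
  also have "\<dots> = (ip f f - c * ip f g) - c * (ip f g - c * ip g g)"
    by (simp add: ip_cmul[OF g d] ip_sym[of f "\<lambda>x. f x - c * g x"] ip_sym[of g "\<lambda>x. f x - c * g x"]
        ip_diff[OF f cg f] ip_diff[OF f cg g] ip_cmul[OF g f] ip_cmul[OF g g] ip_sym[of g f])
  finally show ?thesis by (simp add: algebra_simps power2_eq_square)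
qed

lemma ip_Cauchy_Schwarz:
  assumes f: "CR f" and g: "CR g"
  shows "(ip f g)\<^sup>2 \<le> ip f f * ip g g"
proof (cases "ip g g = 0")
  case True
  then have "ip f g = ip f (\<lambda>x. 0)"
    using ip_eq_0[OF g] by (intro ip_cong) auto
  then have "ip f g = 0" by (simp add: ip_def mean_const)
  then show ?thesis using ip_nonneg f g by simp
next
  case False
  define c where "c = ip f g / ip g g"
  have pos: "ip g g > 0" using ip_nonneg[OF g] False by simp
  have "0 \<le> ip (\<lambda>x. f x - c * g x) (\<lambda>x. f x - c * g x)"
    by (intro ip_nonneg continuous_map_diff f continuous_map_real_mult_left g)
  also have "\<dots> = ip f f - (ip f g)\<^sup>2 / ip g g"
    unfolding ip_square_diff[OF f g] c_def using False by (simp add: power2_eq_square field_simps)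
  finally show ?thesis using pos by (simp add: field_simps)
qed

definition orthonormal :: "nat \<Rightarrow> (nat \<Rightarrow> 'a \<Rightarrow> real) \<Rightarrow> bool" where
  "orthonormal n e \<longleftrightarrow> (\<forall>i<n. CR (e i)) \<and> (\<forall>i<n. \<forall>j<n. ip (e i) (e j) = (if i = j then 1 else 0))"

lemma CR_lincomb: "(\<And>i. i < (n :: nat) \<Longrightarrow> CR (e i)) \<Longrightarrow> CR (\<lambda>x. \<Sum>i<n. c i * e i x)"
  by (intro continuous_map_sum continuous_map_real_mult_left) auto

lemma ip_lincomb_orthonormal:
  assumes "orthonormal n e" "j < n"
  shows "ip (\<lambda>x. \<Sum>i<n. c i * e i x) (e j) = c j"
proof -
  have "ip (\<lambda>x. \<Sum>i<n. c i * e i x) (e j) = (\<Sum>i<n. c i * ip (e i) (e j))"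
    by (rule ip_sum) (use assms in \<open>auto simp: orthonormal_def\<close>)
  also have "\<dots> = (\<Sum>i<n. if i = j then c i else 0)"
    using assms by (intro sum.cong) (auto simp: orthonormal_def)
  also have "\<dots> = c j" using assms(2) by simp
  finally show ?thesis .
qed

lemma Bessel:
  assumes e: "orthonormal n e" and g: "CR g"
  shows "(\<Sum>i<n. (ip (e i) g)\<^sup>2) \<le> ip g g"
proof -
  define p where "p = (\<lambda>x. \<Sum>i<n. ip (e i) g * e i x)"
  have ce: "\<And>i. i < n \<Longrightarrow> CR (e i)" using e by (simp add: orthonormal_def)
  have p: "CR p" unfolding p_def by (rule CR_lincomb[OF ce])
  have pg: "ip p h = (\<Sum>i<n. ip (e i) g * ip (e i) h)" if "CR h" for h
    unfolding p_def by (rule ip_sum[OF ce that])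
  have "ip p p = (\<Sum>i<n. (ip (e i) g)\<^sup>2)"
    unfolding pg[OF p] using ip_lincomb_orthonormal[OF e] ip_sym[of _ p]
    by (intro sum.cong) (auto simp: p_def power2_eq_square)
  moreover have "ip g p = (\<Sum>i<n. (ip (e i) g)\<^sup>2)"
    by (simp add: ip_sym[of g p] pg[OF g] power2_eq_square)
  moreover have "0 \<le> ip (\<lambda>x. g x - 1 * p x) (\<lambda>x. g x - 1 * p x)"
    by (intro ip_nonneg continuous_map_diff g continuous_map_real_mult_left p)
  ultimately show ?thesis unfolding ip_square_diff[OF g p] by simp
qed

definition conv :: "('a \<Rightarrow> real) \<Rightarrow> ('a \<Rightarrow> real) \<Rightarrow> 'a \<Rightarrow> real" where
  "conv k f x = ip f (\<lambda>y. k (inv y \<otimes> x))"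

text \<open>The orthogonal complement of the continuous functions invariant under translation by
  \<open>s\<close>. A nonzero member cannot be invariant itself, since it would be orthogonal to
  itself.\<close>

definition perp :: "'a \<Rightarrow> ('a \<Rightarrow> real) \<Rightarrow> bool" where
  "perp s f \<longleftrightarrow> CR f \<and> (\<forall>u. CR u \<and> (\<forall>x\<in>carrier G. u (s \<otimes> x) = u x) \<longrightarrow> ip f u = 0)"

section \<open>Convolution with a fixed symmetric kernel\<close>

context
  fixes k :: "'a \<Rightarrow> real" and b :: real
  assumes k: "CR k" and k_inv: "\<And>x. x \<in> carrier G \<Longrightarrow> k (inv x) = k x"
    and b: "b > 0" "\<And>x. x \<in> carrier G \<Longrightarrow> \<bar>k x\<bar> \<le> b"
begin

lemma CR2_kernel: "CR2 (\<lambda>x y. k (inv y \<otimes> x))"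
  by (rule continuous_map_real_comp[OF k]) (intro group_cont)

lemma CR_kernel: "x \<in> carrier G \<Longrightarrow> CR (\<lambda>y. k (inv y \<otimes> x))"
  by (rule CR2_sect1[OF CR2_kernel])

lemma CR2_conv: "CR f \<Longrightarrow> CR2 (\<lambda>x y. f y * k (inv y \<otimes> x))"
  by (rule continuous_map_real_mult[OF continuous_map_real_comp CR2_kernel]) (auto intro: group_cont)

lemma CR_conv: "CR f \<Longrightarrow> CR (conv k f)"
  unfolding conv_def[abs_def] ip_def by (rule CR_mean[OF CR2_conv])

lemma conv_cong: "(\<And>y. y \<in> carrier G \<Longrightarrow> f y = g y) \<Longrightarrow> conv k f x = conv k g x"
  unfolding conv_def by (rule ip_cong) auto

text \<open>Cauchy-Schwarz: the quadratic norm of \<open>f\<close> controls the values of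
  \<open>conv k f\<close> at all points, so smallness in the mean becomes uniform after one
  convolution.\<close>

lemma conv_bound: "CR f \<Longrightarrow> x \<in> carrier G \<Longrightarrow> (conv k f x)\<^sup>2 \<le> b\<^sup>2 * ip f f"
proof -
  assume f: "CR f" and x: "x \<in> carrier G"
  have "(conv k f x)\<^sup>2 \<le> ip f f * ip (\<lambda>y. k (inv y \<otimes> x)) (\<lambda>y. k (inv y \<otimes> x))"
    unfolding conv_def by (rule ip_Cauchy_Schwarz[OF f CR_kernel[OF x]])
  also have "\<dots> \<le> ip f f * b\<^sup>2"
    by (intro mult_left_mono ip_le_square CR_kernel x ip_nonneg f) (use b x in auto)
  finally show ?thesis by (simp add: mult.commute)
qed

lemma conv_bound_sup:
  assumes f: "CR f" and x: "x \<in> carrier G" and a: "a \<ge> 0" "\<And>y. y \<in> carrier G \<Longrightarrow> \<bar>f y\<bar> \<le> a"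
  shows "\<bar>conv k f x\<bar> \<le> b * a"
proof -
  have "(conv k f x)\<^sup>2 \<le> b\<^sup>2 * ip f f" by (rule conv_bound[OF f x])
  also have "\<dots> \<le> b\<^sup>2 * a\<^sup>2" by (intro mult_left_mono ip_le_square f a) auto
  finally have "(conv k f x)\<^sup>2 \<le> (b * a)\<^sup>2" by (simp add: power_mult_distrib)
  then show ?thesis using b(1) a(1) by (simp add: abs_le_square_iff[symmetric])
qed

text \<open>Cauchy-Schwarz against the difference of two kernels. \<open>U\<close> depends on
  \<open>k\<close> alone, so the image of the whole unit ball is equicontinuous; this is the
  compactness of the operator.\<close>

lemma conv_equicontinuous:
  assumes x: "x \<in> carrier G" and "e > 0"
  obtains U where "openin T U" "x \<in> U"
    "\<And>f y. CR f \<Longrightarrow> ip f f \<le> 1 \<Longrightarrow> y \<in> U \<Longrightarrow> \<bar>conv k f y - conv k f x\<bar> < e"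
proof -
  have xT: "x \<in> topspace T" using x by (simp add: topspace_eq_carrier)
  obtain U where U: "openin T U" "x \<in> U"
    "\<And>y x'. y \<in> topspace T \<Longrightarrow> x' \<in> U \<Longrightarrow> \<bar>k (inv y \<otimes> x') - k (inv y \<otimes> x)\<bar> < e/2"
    using continuous_map_uniform_in_first[OF compact CR2_swap[OF CR2_kernel] xT, of "e/2"] \<open>e > 0\<close>
    by auto
  show thesis
  proof
    fix f y assume f: "CR f" "ip f f \<le> 1" and "y \<in> U"
    then have y: "y \<in> carrier G" using U(1) openin_subset topspace_eq_carrier by blast
    let ?d = "\<lambda>z. k (inv z \<otimes> y) - k (inv z \<otimes> x)"
    have d: "CR ?d" by (intro continuous_map_diff CR_kernel x y)
    have "conv k f y - conv k f x = ip f ?d"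
      unfolding conv_def by (simp add: ip_sym[of f] ip_diff[OF CR_kernel[OF y] CR_kernel[OF x] f(1)])
    then have "(conv k f y - conv k f x)\<^sup>2 \<le> ip f f * ip ?d ?d"
      using ip_Cauchy_Schwarz[OF f(1) d] by simp
    also have "\<dots> \<le> 1 * (e/2)\<^sup>2"
    proof (intro mult_mono f ip_le_square d)
      show "\<bar>?d z\<bar> \<le> e/2" if "z \<in> carrier G" for z
        using U(3)[of z y] that \<open>y \<in> U\<close> by (simp add: topspace_eq_carrier less_imp_le)
    qed (auto intro: ip_nonneg d)
    finally have "\<bar>conv k f y - conv k f x\<bar> \<le> e/2"
      using \<open>e > 0\<close> by (simp add: abs_le_square_iff[symmetric])
    then show "\<bar>conv k f y - conv k f x\<bar> < e" using \<open>e > 0\<close> by simp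
  qed (fact U)+
qed

lemma conv_cmul: "CR f \<Longrightarrow> x \<in> carrier G \<Longrightarrow> conv k (\<lambda>y. c * f y) x = c * conv k f x"
  unfolding conv_def by (rule ip_cmul[OF _ CR_kernel])

lemma conv_diff:
  "CR f \<Longrightarrow> CR g \<Longrightarrow> x \<in> carrier G \<Longrightarrow> conv k (\<lambda>y. f y - g y) x = conv k f x - conv k g x"
  unfolding conv_def by (rule ip_diff[OF _ _ CR_kernel])

lemma conv_sum:
  "(\<And>i. i < (n :: nat) \<Longrightarrow> CR (e i)) \<Longrightarrow> x \<in> carrier G \<Longrightarrow>
    conv k (\<lambda>y. \<Sum>i<n. c i * e i y) x = (\<Sum>i<n. c i * conv k (e i) x)"
  unfolding conv_def by (rule ip_sum[OF _ CR_kernel])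

text \<open>The two means are exchanged, and invariance of \<open>k\<close> under inversion makes
  the kernel symmetric in \<open>x\<close> and \<open>y\<close>.\<close>

lemma conv_selfadjoint:
  assumes f: "CR f" and g: "CR g"
  shows "ip (conv k f) g = ip f (conv k g)"
proof -
  let ?F = "\<lambda>x y. (f y * k (inv y \<otimes> x)) * g x"
  have F: "CR2 ?F"
    by (rule continuous_map_real_mult[OF CR2_conv[OF f]], rule continuous_map_real_comp[OF g])
      (intro group_cont)
  have "ip (conv k f) g = mean (\<lambda>x. mean (\<lambda>y. ?F x y))"
    unfolding ip_def[of "conv k f"]
  proof (rule mean_cong)
    fix x assume x: "x \<in> carrier G"
    have "mean (\<lambda>y. ?F x y) = mean (\<lambda>y. g x * (f y * k (inv y \<otimes> x)))"
      by (simp add: mult.commute)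
    also have "\<dots> = g x * mean (\<lambda>y. f y * k (inv y \<otimes> x))"
      by (intro mean_cmul continuous_map_real_mult f CR_kernel x)
    finally show "conv k f x * g x = mean (\<lambda>y. ?F x y)"
      by (simp add: conv_def ip_def mult.commute)
  qed
  also have "\<dots> = mean (\<lambda>y. mean (\<lambda>x. ?F x y))"
    by (rule mean_swap[OF F])
  also have "\<dots> = ip f (conv k g)"
    unfolding ip_def[of f]
  proof (rule mean_cong)
    fix y assume y: "y \<in> carrier G"
    have "mean (\<lambda>x. ?F x y) = mean (\<lambda>x. f y * (g x * k (inv x \<otimes> y)))"
    proof (rule mean_cong)
      fix x assume x: "x \<in> carrier G"
      have "k (inv y \<otimes> x) = k (inv x \<otimes> y)"
        using k_inv[of "inv x \<otimes> y"] x y by (simp add: inv_mult_group)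
      then show "?F x y = f y * (g x * k (inv x \<otimes> y))" by simp
    qed
    also have "\<dots> = f y * mean (\<lambda>x. g x * k (inv x \<otimes> y))"
      by (intro mean_cmul continuous_map_real_mult g CR_kernel y)
    finally show "mean (\<lambda>x. ?F x y) = f y * conv k g y"
      by (simp add: conv_def ip_def)
  qed
  finally show ?thesis .
qed

text \<open>The kernel does not change when \<open>x\<close> and \<open>y\<close> are both
  translated by \<open>a\<close>, and the mean is left invariant.\<close>

lemma conv_translate:
  assumes f: "CR f" and a: "a \<in> carrier G" and x: "x \<in> carrier G"
  shows "conv k (\<lambda>y. f (a \<otimes> y)) x = conv k f (a \<otimes> x)"
proof -
  have ax: "a \<otimes> x \<in> carrier G" using a x by simp
  have "conv k f (a \<otimes> x) = mean (\<lambda>y. f (a \<otimes> y) * k (inv (a \<otimes> y) \<otimes> (a \<otimes> x)))"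
    unfolding conv_def ip_def
    by (rule mean_left[symmetric, OF _ a]) (intro continuous_map_real_mult f CR_kernel ax)
  also have "\<dots> = conv k (\<lambda>y. f (a \<otimes> y)) x"
    unfolding conv_def ip_def
  proof (rule mean_cong)
    fix y assume y: "y \<in> carrier G"
    have "inv (a \<otimes> y) \<otimes> (a \<otimes> x) = inv y \<otimes> (inv a \<otimes> (a \<otimes> x))"
      using a x y by (simp add: inv_mult_group m_assoc)
    also have "inv a \<otimes> (a \<otimes> x) = x"
      using a x by (simp flip: m_assoc)
    finally show "f (a \<otimes> y) * k (inv (a \<otimes> y) \<otimes> (a \<otimes> x)) = f (a \<otimes> y) * k (inv y \<otimes> x)" by simp
  qed
  finally show ?thesis by simp
qed

text \<open>Convolution preserves \<open>s\<close>-invariant functions by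
  \<open>conv_translate\<close>, hence by self-adjointness also their orthogonal complement.\<close>

lemma perp_conv:
  assumes f: "perp s f" and s: "s \<in> carrier G"
  shows "perp s (conv k f)"
  unfolding perp_def
proof (intro conjI allI impI)
  have cf: "CR f" using f by (simp add: perp_def)
  then show "CR (conv k f)" by (rule CR_conv)
  fix u assume u: "CR u \<and> (\<forall>x\<in>carrier G. u (s \<otimes> x) = u x)"
  have "conv k u (s \<otimes> x) = conv k u x" if x: "x \<in> carrier G" for x
    using conv_translate[of u s x] u s x conv_cong[of "\<lambda>y. u (s \<otimes> y)" u x] by simp
  then have "ip f (conv k u) = 0"
    using f CR_conv[of u] u by (simp add: perp_def)
  then show "ip (conv k f) u = 0"
    using conv_selfadjoint[OF cf] u by simp
qed

text \<open>
  The largest eigenvalue of \<open>conv k \<circ> conv k\<close> on \<open>perp s\<close> is attained: images of a maximizing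
  sequence converge uniformly along a subsequence by Arzela-Ascoli, so that no completion of the
  space of continuous functions is needed.
\<close>

lemma ex_eigenfunction:
  assumes s: "s \<in> carrier G" and f0: "perp s f0" and x0: "x0 \<in> carrier G" "conv k f0 x0 \<noteq> 0"
  obtains h \<mu> x where "perp s h" "\<mu> > 0" "x \<in> carrier G" "h x \<noteq> 0"
    "\<And>x. x \<in> carrier G \<Longrightarrow> conv k (conv k h) x = \<mu> * h x"
proof -
  \<comment> \<open>By self-adjointness \<open>N\<close> is the quadratic form of the squared
    operator. Squaring makes the form nonnegative, so its supremum on the unit ball is the
    eigenvalue sought.\<close>
  define N where "N = (\<lambda>f. ip (conv k f) (conv k f))"
  define P where "P = {N f |f. perp s f \<and> ip f f \<le> 1}"
  define \<mu> where "\<mu> = Sup P"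
  have pCR: "CR f" if "perp s f" for f using that by (simp add: perp_def)
  have N_nonneg: "0 \<le> N f" if "CR f" for f
    unfolding N_def by (intro ip_nonneg CR_conv that)
  have N_bound: "N f \<le> b\<^sup>2 * ip f f" if f: "CR f" for f
  proof -
    have "N f \<le> (sqrt (b\<^sup>2 * ip f f))\<^sup>2"
      unfolding N_def
      by (rule ip_le_square[OF CR_conv[OF f]]) (metis conv_bound f real_le_rsqrt real_sqrt_abs
          real_sqrt_le_iff)
    then show ?thesis using ip_nonneg[OF f] by simp
  qed
  have bdd: "bdd_above P"
  proof (rule bdd_aboveI)
    fix t assume "t \<in> P"
    then obtain f where f: "perp s f" "ip f f \<le> 1" "t = N f" unfolding P_def by blast
    have "b\<^sup>2 * ip f f \<le> b\<^sup>2 * 1" by (intro mult_left_mono f) auto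
    then show "t \<le> b\<^sup>2" using N_bound[OF pCR[OF f(1)]] f(3) by simp
  qed
  have perp_cmul: "perp s (\<lambda>x. c * f x)" if "perp s f" for c f
    using that by (auto simp: perp_def ip_cmul continuous_map_real_mult_left)
  have N_cmul: "N (\<lambda>x. c * f x) = c\<^sup>2 * N f" if f: "CR f" for c f
  proof -
    have "N (\<lambda>x. c * f x) = ip (\<lambda>x. c * conv k f x) (\<lambda>x. c * conv k f x)"
      unfolding N_def by (intro ip_cong conv_cmul f)
    also have "\<dots> = c * (c * ip (conv k f) (conv k f))"
      using ip_cmul[OF CR_conv[OF f] continuous_map_real_mult_left[OF CR_conv[OF f]], of c c]
        ip_cmul[OF CR_conv[OF f] CR_conv[OF f], of c] ip_sym by metis
    finally show ?thesis by (simp add: N_def power2_eq_square)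
  qed
  have N_le: "N f \<le> \<mu> * ip f f" if f: "perp s f" for f
  proof (cases "ip f f = 0")
    case True
    then show ?thesis using N_bound[OF pCR[OF f]] by simp
  next
    case False
    then have pos: "ip f f > 0" using ip_nonneg[OF pCR[OF f]] by simp
    let ?c = "1 / sqrt (ip f f)"
    have "ip (\<lambda>x. ?c * f x) (\<lambda>x. ?c * f x) = ?c * (?c * ip f f)"
      using ip_cmul[OF pCR[OF f] continuous_map_real_mult_left[OF pCR[OF f]], of ?c ?c]
        ip_cmul[OF pCR[OF f] pCR[OF f], of ?c] ip_sym by metis
    also have "\<dots> = 1" using pos by (simp add: field_simps)
    finally have "ip (\<lambda>x. ?c * f x) (\<lambda>x. ?c * f x) \<le> 1" by simp
    then have "N (\<lambda>x. ?c * f x) \<in> P"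
      unfolding P_def using perp_cmul[OF f] by blast
    then have "N (\<lambda>x. ?c * f x) \<le> \<mu>"
      unfolding \<mu>_def by (rule cSup_upper[OF _ bdd])
    then have "?c\<^sup>2 * N f \<le> \<mu>" by (simp only: N_cmul[OF pCR[OF f]])
    then show ?thesis using pos by (simp add: power_divide field_simps)
  qed
  have mu_pos: "\<mu> > 0"
  proof -
    have "ip (conv k f0) (conv k f0) \<noteq> 0"
      using ip_eq_0[OF CR_conv[OF pCR[OF f0]] _ x0(1)] x0(2) by blast
    then have "N f0 > 0" using N_nonneg[OF pCR[OF f0]] by (simp add: N_def)
    then have "0 < \<mu> * ip f0 f0" using N_le[OF f0] by linarith
    then show ?thesis using ip_nonneg[OF pCR[OF f0]] by (simp add: zero_less_mult_iff)
  qed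
  have "\<exists>f. perp s f \<and> ip f f \<le> 1 \<and> N f > \<mu> - 1 / real (Suc n)" for n
  proof -
    have "P \<noteq> {}"
      using perp_cmul[OF f0, of 0] by (auto simp: P_def ip_def mean_const intro!: exI[of _ "\<lambda>x. 0"])
    moreover have "\<mu> - 1 / real (Suc n) < Sup P" by (simp add: \<mu>_def)
    ultimately obtain t where "t \<in> P" "t > \<mu> - 1 / real (Suc n)"
      using less_cSup_iff[OF _ bdd] by blast
    then show ?thesis unfolding P_def by blast
  qed
  then obtain f where f: "\<And>n. perp s (f n)" "\<And>n. ip (f n) (f n) \<le> 1"
    "\<And>n. N (f n) > \<mu> - 1 / real (Suc n)" by metis
  have Cf: "CR (f n)" for n using pCR f(1) .
  have bnd: "\<bar>conv k (f n) x\<bar> \<le> b" if "x \<in> topspace T" for n x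
  proof -
    have "(conv k (f n) x)\<^sup>2 \<le> b\<^sup>2 * ip (f n) (f n)"
      using conv_bound[OF Cf] that by (simp add: topspace_eq_carrier)
    also have "\<dots> \<le> b\<^sup>2 * 1" by (intro mult_left_mono f) auto
    finally show ?thesis using b(1) by (simp add: abs_le_square_iff[symmetric])
  qed
  have eqc: "\<exists>U. openin T U \<and> x \<in> U \<and> (\<forall>n. \<forall>y\<in>U. \<bar>conv k (f n) y - conv k (f n) x\<bar> < e)"
    if x: "x \<in> topspace T" and e: "e > 0" for x e
  proof -
    have "x \<in> carrier G" using x by (simp add: topspace_eq_carrier)
    then obtain U where "openin T U" "x \<in> U"
      "\<And>f y. CR f \<Longrightarrow> ip f f \<le> 1 \<Longrightarrow> y \<in> U \<Longrightarrow> \<bar>conv k f y - conv k f x\<bar> < e"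
      using e by (rule conv_equicontinuous) blast
    then show ?thesis using Cf f(2) by blast
  qed
  obtain r h where r: "strict_mono (r :: nat \<Rightarrow> nat)" and h: "CR h"
    and unif: "\<And>e. e > 0 \<Longrightarrow> \<exists>M. \<forall>n\<ge>M. \<forall>x\<in>topspace T. \<bar>conv k (f (r n)) x - h x\<bar> < e"
    using Arzela_Ascoli_separable[OF compact separable, of "\<lambda>n. conv k (f n)" b] bnd eqc by blast
  define g where "g = (\<lambda>n. f (r n))"
  have g: "perp s (g n)" "ip (g n) (g n) \<le> 1" "CR (g n)" for n
    using f Cf by (auto simp: g_def)
  have Ng: "N (g n) > \<mu> - 1 / real (Suc n)" for n
  proof -
    have "1 / real (Suc (r n)) \<le> 1 / real (Suc n)"
      using seq_suble[OF r, of n] by (intro divide_left_mono) auto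
    then show ?thesis using f(3)[of "r n"] unfolding g_def by linarith
  qed
  have unif: "\<exists>M. \<forall>n\<ge>M. \<forall>x\<in>carrier G. \<bar>conv k (g n) x - h x\<bar> < e" if "e > 0" for e
    using unif[OF that] unfolding g_def topspace_eq_carrier .
  \<comment> \<open>\<open>h\<close> is the uniform limit of the images \<open>conv k (g n)\<close>,
    which stay in \<open>perp s\<close>; the functions \<open>g n\<close> themselves need not
    converge.\<close>
  have perp_h: "perp s h"
    unfolding perp_def
  proof (intro conjI allI impI h)
    fix u assume u: "CR u \<and> (\<forall>x\<in>carrier G. u (s \<otimes> x) = u x)"
    then have Cu: "CR u" by simp
    obtain B where B: "B > 0" "\<And>x. x \<in> carrier G \<Longrightarrow> \<bar>u x\<bar> \<le> B"
      using compact_space_real_bounded[OF compact Cu] topspace_eq_carrier by metis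
    have "\<bar>ip h u\<bar> \<le> 0 + e" if "e > 0" for e
    proof -
      obtain M where M: "\<And>x. x \<in> carrier G \<Longrightarrow> \<bar>conv k (g M) x - h x\<bar> < e / B"
        using unif[of "e / B"] \<open>e > 0\<close> B(1) by auto
      have "\<bar>ip (conv k (g M)) u - ip h u\<bar> \<le> e"
        unfolding ip_def
      proof (intro mean_close continuous_map_real_mult CR_conv g h Cu)
        fix x assume x: "x \<in> carrier G"
        have "\<bar>conv k (g M) x * u x - h x * u x\<bar> = \<bar>conv k (g M) x - h x\<bar> * \<bar>u x\<bar>"
          by (simp add: left_diff_distrib flip: abs_mult)
        also have "\<dots> \<le> (e / B) * B"
          using M[OF x] B x \<open>e > 0\<close> by (intro mult_mono) auto
        finally show "\<bar>conv k (g M) x * u x - h x * u x\<bar> \<le> e" using B(1) by simp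
      qed
      moreover have "ip (conv k (g M)) u = 0"
        using perp_conv[OF g(1) s, of M] u by (simp add: perp_def)
      ultimately show ?thesis by simp
    qed
    then have "\<bar>ip h u\<bar> \<le> 0" by (rule field_le_epsilon)
    then show "ip h u = 0" by simp
  qed
  \<comment> \<open>If \<open>h\<close> vanished, the images would tend to 0 uniformly and
    \<open>N (g n)\<close> would drop below \<open>\<mu> / 2\<close>, although it tends to
    \<open>\<mu>\<close>.\<close>
  have "\<exists>x\<in>carrier G. h x \<noteq> 0"
  proof (rule ccontr)
    assume "\<not> (\<exists>x\<in>carrier G. h x \<noteq> 0)"
    then have h0: "\<And>x. x \<in> carrier G \<Longrightarrow> h x = 0" by blast
    obtain M where M: "\<And>n x. n \<ge> M \<Longrightarrow> x \<in> carrier G \<Longrightarrow> \<bar>conv k (g n) x - h x\<bar> < sqrt (\<mu> / 2)"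
      using unif[of "sqrt (\<mu> / 2)"] mu_pos by auto
    obtain L where L: "inverse (real (Suc L)) < \<mu> / 2"
      using reals_Archimedean[of "\<mu> / 2"] mu_pos by auto
    define n where "n = max M L"
    have "N (g n) \<le> (sqrt (\<mu> / 2))\<^sup>2"
      unfolding N_def
    proof (intro ip_le_square CR_conv g)
      fix x assume x: "x \<in> carrier G"
      have "\<bar>conv k (g n) x - h x\<bar> < sqrt (\<mu> / 2)" by (rule M[OF _ x]) (simp add: n_def)
      then show "\<bar>conv k (g n) x\<bar> \<le> sqrt (\<mu> / 2)" using h0[OF x] by simp
    qed
    then have "N (g n) \<le> \<mu> / 2" using mu_pos by simp
    moreover have "1 / real (Suc n) \<le> 1 / real (Suc L)"
      by (intro divide_left_mono) (auto simp: n_def)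
    ultimately show False using Ng[of n] L by (simp add: inverse_eq_divide)
  qed
  then obtain x1 where x1: "x1 \<in> carrier G" "h x1 \<noteq> 0" by blast
  let ?T = "conv k"
  \<comment> \<open>The threefold image of \<open>g n\<close> tends to \<open>?T (?T h)\<close>, and
    \<open>\<mu> * ?T (g n)\<close> tends to \<open>\<mu> * h\<close>. Their difference is the image
    of \<open>?T (?T (g n)) - \<mu> * g n\<close>, whose quadratic norm tends to 0 because
    \<open>g n\<close> is maximizing.\<close>
  have eig: "?T (?T h) x = \<mu> * h x" if x: "x \<in> carrier G" for x
  proof -
    have lim1: "(\<lambda>n. \<mu> * ?T (g n) x) \<longlonglongrightarrow> \<mu> * h x"
    proof (rule tendsto_mult_left, rule LIMSEQ_I)
      fix e :: real assume "e > 0"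
      then show "\<exists>M. \<forall>n\<ge>M. norm (?T (g n) x - h x) < e" using unif[of e] x by (metis real_norm_def)
    qed
    have lim2: "(\<lambda>n. ?T (?T (?T (g n))) x) \<longlonglongrightarrow> ?T (?T h) x"
    proof (rule LIMSEQ_I)
      fix e :: real assume "e > 0"
      \<comment> \<open>Each of the two outer convolutions costs a factor \<open>b\<close>; the 2
        yields a strict inequality.\<close>
      then have pos: "e / (2 * b\<^sup>2) > 0" using b(1) by simp
      obtain M where M: "\<And>n x. n \<ge> M \<Longrightarrow> x \<in> carrier G \<Longrightarrow> \<bar>?T (g n) x - h x\<bar> < e / (2 * b\<^sup>2)"
        using unif[OF pos] by blast
      have "norm (?T (?T (?T (g n))) x - ?T (?T h) x) < e" if "n \<ge> M" for n
      proof -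
        let ?d = "\<lambda>y. ?T (g n) y - h y"
        have d: "CR ?d" by (intro continuous_map_diff CR_conv g h)
        have "?T (?T (?T (g n))) x - ?T (?T h) x = ?T (\<lambda>y. ?T (?T (g n)) y - ?T h y) x"
          by (rule conv_diff[symmetric]) (intro CR_conv g h x)+
        also have "\<dots> = ?T (?T ?d) x"
          by (rule conv_cong, rule conv_diff[symmetric]) (intro CR_conv g h | assumption)+
        finally have eq: "?T (?T (?T (g n))) x - ?T (?T h) x = ?T (?T ?d) x" .
        have "\<bar>?T ?d y\<bar> \<le> b * (e / (2 * b\<^sup>2))" if "y \<in> carrier G" for y
          by (rule conv_bound_sup[OF d that]) (use pos M[OF \<open>n \<ge> M\<close>] in \<open>auto simp: less_imp_le\<close>)
        then have "\<bar>?T (?T ?d) x\<bar> \<le> b * (b * (e / (2 * b\<^sup>2)))"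
          using pos b(1) by (intro conv_bound_sup[OF CR_conv[OF d] x] mult_nonneg_nonneg) auto
        also have "\<dots> = e / 2" using b(1) by (simp add: power2_eq_square)
        also have "\<dots> < e" using \<open>e > 0\<close> by simp
        finally show ?thesis using eq by simp
      qed
      then show "\<exists>M. \<forall>n\<ge>M. norm (?T (?T (?T (g n))) x - ?T (?T h) x) < e" by blast
    qed
    have bound: "(?T (?T (?T (g n))) x - \<mu> * ?T (g n) x)\<^sup>2 \<le> b\<^sup>2 * (2 * \<mu> * (1 / real (Suc n)))" for n
    proof -
      have TT: "CR (?T (?T (g n)))" by (intro CR_conv g)
      let ?d = "\<lambda>y. ?T (?T (g n)) y - \<mu> * g n y"
      have "?T (?T (?T (g n))) x - \<mu> * ?T (g n) x = ?T ?d x"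
        by (simp add: conv_diff[OF TT continuous_map_real_mult_left[OF g(3)] x] conv_cmul[OF g(3) x])
      then have "(?T (?T (?T (g n))) x - \<mu> * ?T (g n) x)\<^sup>2 \<le> b\<^sup>2 * ip ?d ?d"
        using conv_bound[of ?d x] x TT g(3)
        by (simp add: continuous_map_diff continuous_map_real_mult_left)
      also have "\<dots> \<le> b\<^sup>2 * (2 * \<mu> * (1 / real (Suc n)))"
      proof (rule mult_left_mono)
        \<comment> \<open>Expanding the square gives
          \<open>N (?T (g n)) - 2 * \<mu> * N (g n)\<close> plus
          \<open>\<mu>\<^sup>2 * ip (g n) (g n)\<close>; the first and last terms are each at most
          \<open>\<mu>\<^sup>2\<close>.\<close>
        have "N (?T (g n)) \<le> \<mu> * N (g n)"
          using N_le[OF perp_conv[OF g(1) s]] by (simp add: N_def)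
        moreover have "\<mu> * N (g n) \<le> \<mu> * (\<mu> * 1)"
        proof (rule mult_left_mono)
          have "\<mu> * ip (g n) (g n) \<le> \<mu> * 1" using mu_pos g(2) by (intro mult_left_mono) auto
          then show "N (g n) \<le> \<mu> * 1" using N_le[OF g(1), of n] by linarith
        qed (use mu_pos in simp)
        moreover have "\<mu>\<^sup>2 * ip (g n) (g n) \<le> \<mu>\<^sup>2 * 1" using g(2) by (intro mult_left_mono) auto
        moreover have "ip (?T (?T (g n))) (g n) = N (g n)"
          using conv_selfadjoint[OF CR_conv[OF g(3)] g(3), of n n] by (simp add: N_def)
        ultimately have "ip ?d ?d \<le> 2 * \<mu> * \<mu> - 2 * \<mu> * N (g n)"
          unfolding ip_square_diff[OF TT g(3)] by (simp add: N_def power2_eq_square)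
        also have "\<dots> = 2 * \<mu> * (\<mu> - N (g n))" by (simp add: algebra_simps)
        also have "\<dots> \<le> 2 * \<mu> * (1 / real (Suc n))"
          using Ng[of n] mu_pos by (intro mult_left_mono) auto
        finally show "ip ?d ?d \<le> 2 * \<mu> * (1 / real (Suc n))" .
      qed simp
      finally show ?thesis .
    qed
    have "(\<lambda>n. b\<^sup>2 * (2 * \<mu> * (1 / real (Suc n)))) \<longlonglongrightarrow> b\<^sup>2 * (2 * \<mu> * 0)"
      by (intro tendsto_mult_left) (rule LIMSEQ_Suc[OF lim_1_over_n])
    moreover have "(\<lambda>n. (?T (?T (?T (g n))) x - \<mu> * ?T (g n) x)\<^sup>2) \<longlonglongrightarrow> (?T (?T h) x - \<mu> * h x)\<^sup>2"
      by (intro tendsto_intros lim1 lim2)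
    ultimately have "(?T (?T h) x - \<mu> * h x)\<^sup>2 \<le> b\<^sup>2 * (2 * \<mu> * 0)"
      using bound by (intro LIMSEQ_le) auto
    then show ?thesis by simp
  qed
  show thesis by (rule that[OF perp_h mu_pos x1 eig])
qed

text \<open>Trace bound: for orthonormal eigenfunctions, Bessel's inequality for the kernel at each
  point, averaged over the group, gives \<open>n * \<mu> \<le> b\<^sup>2\<close>. A largest
  orthonormal family therefore spans the eigenspace, which left translations preserve;
  \<open>c\<close> is the matrix of this action.\<close>

lemma eigenspace_matrix_rep:
  assumes "\<mu> > 0"
  shows "\<exists>n c. matrix_rep n c \<and>
    (\<forall>f s. CR f \<and> (\<forall>x\<in>carrier G. conv k (conv k f) x = \<mu> * f x) \<and> s \<in> carrier G \<and>
       (\<forall>i<n. \<forall>j<n. c i j s = c i j \<one>) \<longrightarrow> (\<forall>x\<in>carrier G. f (s \<otimes> x) = f x))"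
proof -
  define E where "E = {f. CR f \<and> (\<forall>x\<in>carrier G. conv k (conv k f) x = \<mu> * f x)}"
  define Q where "Q = (\<lambda>n. \<exists>e. orthonormal n e \<and> (\<forall>i<n. e i \<in> E))"
  have EC: "CR f" if "f \<in> E" for f using that by (simp add: E_def)
  have bound: "real n \<le> b\<^sup>2 / \<mu>" if Qn: "Q n" for n
  proof -
    obtain e where e: "orthonormal n e" "\<And>i. i < n \<Longrightarrow> e i \<in> E" using Qn unfolding Q_def by blast
    have ce: "CR (e i)" if "i < n" for i using EC[OF e(2)[OF that]] .
    have eq: "ip (conv k (e i)) (conv k (e i)) = \<mu>" if i: "i < n" for i
    proof -
      have "ip (conv k (e i)) (conv k (e i)) = ip (conv k (conv k (e i))) (e i)"
        by (rule conv_selfadjoint[symmetric]) (intro CR_conv ce i)+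
      also have "\<dots> = ip (\<lambda>x. \<mu> * e i x) (e i)"
        using e(2)[OF i] by (intro ip_cong) (auto simp: E_def)
      also have "\<dots> = \<mu> * ip (e i) (e i)"
        by (rule ip_cmul[OF ce ce]) (rule i)+
      also have "ip (e i) (e i) = 1" using e(1) i by (simp add: orthonormal_def)
      finally show ?thesis by simp
    qed
    have cs: "CR (\<lambda>x. conv k (e i) x * conv k (e i) x)" if "i < n" for i
      by (intro continuous_map_real_mult CR_conv ce that)
    have "mean (\<lambda>x. \<Sum>i<n. conv k (e i) x * conv k (e i) x) = (\<Sum>i<n. ip (conv k (e i)) (conv k (e i)))"
      unfolding ip_def by (rule mean_sum) (use cs in auto)
    also have "\<dots> = real n * \<mu>" using eq by simp
    finally have "real n * \<mu> = mean (\<lambda>x. \<Sum>i<n. conv k (e i) x * conv k (e i) x)" by simp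
    also have "\<dots> \<le> mean (\<lambda>x. b\<^sup>2)"
    proof (rule mean_mono)
      show "CR (\<lambda>x. \<Sum>i<n. conv k (e i) x * conv k (e i) x)"
        by (rule continuous_map_sum) (use cs in auto)
      fix x assume x: "x \<in> carrier G"
      have "(\<Sum>i<n. (ip (e i) (\<lambda>y. k (inv y \<otimes> x)))\<^sup>2)
          \<le> ip (\<lambda>y. k (inv y \<otimes> x)) (\<lambda>y. k (inv y \<otimes> x))"
        by (rule Bessel[OF e(1) CR_kernel[OF x]])
      also have "\<dots> \<le> b\<^sup>2" by (rule ip_le_square[OF CR_kernel[OF x]]) (use b x in auto)
      finally show "(\<Sum>i<n. conv k (e i) x * conv k (e i) x) \<le> b\<^sup>2"
        by (simp add: conv_def power2_eq_square)
    qed simp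
    finally show ?thesis using \<open>\<mu> > 0\<close> by (simp add: mean_const field_simps)
  qed
  have "Q 0" by (simp add: Q_def orthonormal_def)
  moreover have "\<forall>m. Q m \<longrightarrow> m < Suc (nat \<lceil>b\<^sup>2 / \<mu>\<rceil>)"
    using bound by (auto simp: less_Suc_eq_le intro!: nat_le_real_less[THEN iffD2] order.strict_trans1[OF bound])
      linarith
  ultimately obtain n where n: "Q n" "\<And>m. Q m \<Longrightarrow> m \<le> n"
    using ex_has_greatest_nat[of Q 0 id] by (metis id_apply)
  obtain e where e: "orthonormal n e" "\<And>i. i < n \<Longrightarrow> e i \<in> E" using n(1) unfolding Q_def by blast
  have ce: "CR (e i)" if "i < n" for i using EC[OF e(2)[OF that]] .
  have expand: "f x = (\<Sum>i<n. ip f (e i) * e i x)" if f: "f \<in> E" and x: "x \<in> carrier G" for f x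
  proof (rule ccontr)
    assume neq: "f x \<noteq> (\<Sum>i<n. ip f (e i) * e i x)"
    \<comment> \<open>The normalized remainder \<open>f - p\<close> would be a further orthonormal
      eigenfunction, contradicting the maximality of \<open>n\<close>.\<close>
    define p where "p = (\<lambda>x. \<Sum>i<n. ip f (e i) * e i x)"
    define g where "g = (\<lambda>x. f x - p x)"
    have p: "CR p" unfolding p_def by (rule CR_lincomb[OF ce])
    have g: "CR g" unfolding g_def by (intro continuous_map_diff EC f p)
    have g_perp: "ip g (e j) = 0" if "j < n" for j
      unfolding g_def ip_diff[OF EC[OF f] p ce[OF that]]
      using ip_lincomb_orthonormal[OF e(1) that, of "\<lambda>i. ip f (e i)"] by (simp add: p_def)
    have gE: "g \<in> E"
    proof -
      have "conv k (conv k g) y = \<mu> * g y" if y: "y \<in> carrier G" for y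
      proof -
        have "conv k (conv k g) y = conv k (\<lambda>z. conv k f z - conv k p z) y"
          unfolding g_def by (intro conv_cong conv_diff EC f p)
        also have "\<dots> = conv k (conv k f) y - conv k (conv k p) y"
          by (intro conv_diff CR_conv EC f p y)
        also have "conv k (conv k p) y = conv k (\<lambda>z. \<Sum>i<n. ip f (e i) * conv k (e i) z) y"
          unfolding p_def by (intro conv_cong conv_sum ce)
        also have "\<dots> = (\<Sum>i<n. ip f (e i) * conv k (conv k (e i)) y)"
          by (intro conv_sum CR_conv ce y)
        also have "\<dots> = (\<Sum>i<n. ip f (e i) * (\<mu> * e i y))"
          using e(2) y by (intro sum.cong) (auto simp: E_def)
        also have "\<dots> = \<mu> * p y"
          by (simp add: p_def sum_distrib_left mult.left_commute)
        also have "conv k (conv k f) y = \<mu> * f y" using f y by (simp add: E_def)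
        finally show ?thesis by (simp add: g_def right_diff_distrib)
      qed
      then show ?thesis using g by (simp add: E_def)
    qed
    have "g x \<noteq> 0" using neq by (simp add: g_def p_def)
    then have "ip g g \<noteq> 0" using ip_eq_0[OF g _ x] by blast
    then have gg: "ip g g > 0" using ip_nonneg[OF g] by simp
    define a where "a = 1 / sqrt (ip g g)"
    define e' where "e' = (\<lambda>i. if i = n then (\<lambda>x. a * g x) else e i)"
    have ag: "CR (\<lambda>x. a * g x)" by (intro continuous_map_real_mult_left g)
    have "ip (\<lambda>x. a * g x) (\<lambda>x. a * g x) = a * (a * ip g g)"
      using ip_cmul[OF g ag, of a] ip_cmul[OF g g, of a] ip_sym by metis
    then have "ip (\<lambda>x. a * g x) (\<lambda>x. a * g x) = 1" using gg by (simp add: a_def field_simps)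
    moreover have "ip (\<lambda>x. a * g x) (e j) = 0" "ip (e j) (\<lambda>x. a * g x) = 0" if "j < n" for j
      using ip_cmul[OF g ce[OF that], of a] g_perp[OF that] ip_sym by simp_all
    ultimately have "orthonormal (Suc n) e'"
      using e(1) ag ce unfolding orthonormal_def e'_def by (auto simp: less_Suc_eq)
    moreover have "(\<lambda>x. a * g x) \<in> E"
    proof -
      have "conv k (conv k (\<lambda>x. a * g x)) y = \<mu> * (a * g y)" if y: "y \<in> carrier G" for y
      proof -
        have "conv k (conv k (\<lambda>x. a * g x)) y = conv k (\<lambda>z. a * conv k g z) y"
          by (intro conv_cong conv_cmul g)
        also have "\<dots> = a * conv k (conv k g) y" by (intro conv_cmul CR_conv g y)
        finally show ?thesis using gE y by (simp add: E_def)
      qed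
      then show ?thesis using ag by (simp add: E_def)
    qed
    ultimately have "Q (Suc n)"
      unfolding Q_def using e(2) by (intro exI[of _ e']) (auto simp: e'_def less_Suc_eq)
    then show False using n(2) by fastforce
  qed
  have trE: "(\<lambda>x. f (a \<otimes> x)) \<in> E" if f: "f \<in> E" and a: "a \<in> carrier G" for f a
  proof -
    have "conv k (conv k (\<lambda>x. f (a \<otimes> x))) y = \<mu> * f (a \<otimes> y)" if y: "y \<in> carrier G" for y
    proof -
      have "conv k (conv k (\<lambda>x. f (a \<otimes> x))) y = conv k (\<lambda>z. conv k f (a \<otimes> z)) y"
        by (intro conv_cong conv_translate EC f a)
      also have "\<dots> = conv k (conv k f) (a \<otimes> y)"
        by (intro conv_translate CR_conv EC f a y)
      finally show ?thesis using f a y by (simp add: E_def)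
    qed
    then show ?thesis using EC[OF f] a by (simp add: E_def CR_left)
  qed
  define c where "c = (\<lambda>i j a. ip (\<lambda>x. e i (a \<otimes> x)) (e j))"
  have c_expand: "e i (a \<otimes> x) = (\<Sum>j<n. c i j a * e j x)"
    if "i < n" "a \<in> carrier G" "x \<in> carrier G" for i a x
    using expand[OF trE[OF e(2)]] that by (simp add: c_def)
  show ?thesis
  proof (intro exI conjI allI impI ballI)
    show "matrix_rep n c"
      unfolding matrix_rep_def
    proof (intro allI impI conjI ballI)
      fix i j assume i: "i < n" and j: "j < n"
      have "CR2 (\<lambda>a x. e i (a \<otimes> x) * e j x)"
        by (intro continuous_map_real_mult continuous_map_real_comp[OF ce[OF i]]
            continuous_map_real_comp[OF ce[OF j]] continuous_map_mult continuous_map_fst continuous_map_snd)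
      then show "CR (c i j)"
        unfolding c_def ip_def by (rule CR_mean)
      fix a a' assume a: "a \<in> carrier G" and a': "a' \<in> carrier G"
      have "c i j (a \<otimes> a') = ip (\<lambda>x. \<Sum>l<n. c i l a * e l (a' \<otimes> x)) (e j)"
        unfolding c_def by (intro ip_cong) (use a a' i c_expand in \<open>auto simp: m_assoc c_def\<close>)
      also have "\<dots> = (\<Sum>l<n. c i l a * ip (\<lambda>x. e l (a' \<otimes> x)) (e j))"
        by (intro ip_sum CR_left ce a' j)
      finally show "c i j (a \<otimes> a') = (\<Sum>l<n. c i l a * c l j a')"
        by (simp add: c_def)
    qed
  next
    fix f s x
    assume "CR f \<and> (\<forall>x\<in>carrier G. conv k (conv k f) x = \<mu> * f x) \<and> s \<in> carrier G \<and>
       (\<forall>i<n. \<forall>j<n. c i j s = c i j \<one>)" and x: "x \<in> carrier G"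
    then have f: "CR f" "\<And>x. x \<in> carrier G \<Longrightarrow> conv k (conv k f) x = \<mu> * f x"
      and s: "s \<in> carrier G" "\<And>i j. i < n \<Longrightarrow> j < n \<Longrightarrow> c i j s = c i j \<one>"
      by blast+
    have fE: "f \<in> E" using f by (simp add: E_def)
    have "e i (s \<otimes> x) = e i x" if "i < n" for i
      using c_expand[OF that s(1) x] c_expand[OF that one_closed x] s(2)[OF that] x by simp
    then show "f (s \<otimes> x) = f x"
      using expand[OF fE, of "s \<otimes> x"] expand[OF fE x] s(1) x by simp
  qed
qed

end

text \<open>
  If convolution with \<open>k\<close> annihilated \<open>perp s\<close>, then \<open>conv k g\<close> would be \<open>s\<close>-invariant for every
  \<open>g\<close>; testing this with \<open>g y = k (y\<^sup>-\<^sup>1 s) - k (y\<^sup>-\<^sup>1)\<close> forces \<open>k s = k \<one>\<close>. Hence there is an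
  eigenfunction in \<open>perp s\<close>, and its eigenspace is a representation on which \<open>s\<close> acts nontrivially.
\<close>

theorem Peter_Weyl:
  assumes s: "s \<in> carrier G" "s \<noteq> \<one>"
  obtains n c i j where "matrix_rep n c" "i < n" "j < n" "c i j s \<noteq> c i j \<one>"
proof -
  have "completely_regular_space T"
    using compact Hausdorff compact_Hausdorff_or_regular_imp_normal_space
      normal_imp_completely_regular_space by blast
  moreover have "closedin T {s}"
    using s(1) Hausdorff by (simp add: closedin_Hausdorff_singleton topspace_eq_carrier)
  ultimately obtain u where u: "CR u" "u \<one> = 0" "u s = 1"
    using s unfolding completely_regular_space_alt topspace_eq_carrier
    by (metis (no_types, lifting) Diff_iff image_insert insert_subset one_closed singletonD singletonI)
  \<comment> \<open>Symmetrized under inversion; squares keep the two contributions at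
    \<open>s\<close> from cancelling.\<close>
  define k where "k = (\<lambda>x. (u x)\<^sup>2 + (u (inv x))\<^sup>2)"
  have k: "CR k"
    unfolding k_def
    by (intro continuous_map_add continuous_map_real_pow u continuous_map_real_comp[OF u(1)] continuous_inv)
  have k_inv: "k (inv x) = k x" if "x \<in> carrier G" for x
    using that by (simp add: k_def)
  have ks: "k s \<noteq> k \<one>"
  proof -
    have "k s \<ge> 1" by (simp add: k_def u)
    moreover have "k \<one> = 0" by (simp add: k_def u)
    ultimately show ?thesis by simp
  qed
  obtain b where b: "b > 0" "\<And>x. x \<in> carrier G \<Longrightarrow> \<bar>k x\<bar> \<le> b"
    using compact_space_real_bounded[OF compact k] topspace_eq_carrier by metis
  note kernel_facts = k k_inv b
  define g where "g = (\<lambda>y. k (inv y \<otimes> s) - k (inv y \<otimes> \<one>))"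
  have g: "CR g"
    unfolding g_def
    by (intro continuous_map_diff CR_kernel[OF kernel_facts] s one_closed)
  have gs: "CR (\<lambda>y. g (s \<otimes> y))" by (intro CR_left g s)
  define f where "f = (\<lambda>y. g (s \<otimes> y) - g y)"
  have f: "CR f" unfolding f_def by (intro continuous_map_diff gs g)
  have perp_f: "perp s f"
    unfolding perp_def
  proof (intro conjI f allI impI)
    fix v assume v: "CR v \<and> (\<forall>x\<in>carrier G. v (s \<otimes> x) = v x)"
    have "ip (\<lambda>y. g (s \<otimes> y)) v = mean (\<lambda>y. g (s \<otimes> y) * v (s \<otimes> y))"
      unfolding ip_def using v by (intro mean_cong) auto
    also have "\<dots> = ip g v"
      unfolding ip_def using v by (intro mean_left[of "\<lambda>y. g y * v y"] continuous_map_real_mult g s) auto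
    finally show "ip f v = 0"
      unfolding f_def using v by (subst ip_diff[OF gs g]) auto
  qed
  \<comment> \<open>The values of \<open>conv k g\<close> at \<open>s\<close> and
    \<open>\<one>\<close> pair \<open>g\<close> with the two kernels whose difference is
    \<open>g\<close>.\<close>
  have "conv k f \<one> = conv k g (s \<otimes> \<one>) - conv k g \<one>"
    unfolding f_def
    by (simp only: conv_diff[OF kernel_facts gs g one_closed] conv_translate[OF kernel_facts g s(1) one_closed])
  also have "\<dots> = ip g g"
    unfolding conv_def using s ip_diff[OF CR_kernel[OF kernel_facts s(1)] CR_kernel[OF kernel_facts one_closed] g]
      ip_sym[of g "\<lambda>y. k (inv y \<otimes> s)"] ip_sym[of g "\<lambda>y. k (inv y \<otimes> \<one>)"]
    by (simp add: g_def)
  also have "ip g g \<noteq> 0"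
    using ip_eq_0[OF g _ one_closed] ks s by (auto simp: g_def)
  finally have "conv k f \<one> \<noteq> 0" .
  then obtain h \<mu> x where h: "perp s h" "\<mu> > 0" "x \<in> carrier G" "h x \<noteq> 0"
    and eig: "\<And>x. x \<in> carrier G \<Longrightarrow> conv k (conv k h) x = \<mu> * h x"
    using ex_eigenfunction[OF kernel_facts s(1) perp_f one_closed] by metis
  have Ch: "CR h" using h(1) by (simp add: perp_def)
  obtain n c where c: "matrix_rep n c"
    "\<forall>f s. CR f \<and> (\<forall>x\<in>carrier G. conv k (conv k f) x = \<mu> * f x) \<and> s \<in> carrier G \<and>
       (\<forall>i<n. \<forall>j<n. c i j s = c i j \<one>) \<longrightarrow> (\<forall>x\<in>carrier G. f (s \<otimes> x) = f x)"
    using eigenspace_matrix_rep[OF kernel_facts h(2)] by blast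
  have "\<exists>i j. i < n \<and> j < n \<and> c i j s \<noteq> c i j \<one>"
  proof (rule ccontr)
    assume "\<not> ?thesis"
    then have "\<And>x. x \<in> carrier G \<Longrightarrow> h (s \<otimes> x) = h x"
      using c(2) Ch eig s(1) by blast
    then have "ip h h = 0" using h(1) Ch by (simp add: perp_def)
    then show False using ip_eq_0[OF Ch _ h(3)] h(4) by blast
  qed
  then show thesis using that c(1) by blast
qed

end

section \<open>An identity theorem on connected groups\<close>

text \<open>
  The point is that \<open>U\<close> does not depend on \<open>t\<close>: the coefficient vectors of the combinations that
  vanish near \<open>p\<close> form a subspace of a finite-dimensional space. The induction on \<open>n\<close> avoids
  choosing a basis.
\<close>

lemma uniform_neighbourhood_of_vanishing:
  fixes v :: "nat \<Rightarrow> 'a \<Rightarrow> real"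
  assumes "p \<in> topspace X"
  shows "\<exists>U. openin X U \<and> p \<in> U \<and> (\<forall>t W. openin X W \<and> p \<in> W \<and> (\<forall>y\<in>W. (\<Sum>j<n. t j * v j y) = 0) \<longrightarrow>
           (\<forall>y\<in>U. (\<Sum>j<n. t j * v j y) = 0))"
proof (induction n)
  case 0
  then show ?case using assms by (intro exI[of _ "topspace X"]) auto
next
  case (Suc n)
  then obtain U where U: "openin X U" "p \<in> U" and
    U0: "\<forall>t W. openin X W \<and> p \<in> W \<and> (\<forall>y\<in>W. (\<Sum>j<n. t j * v j y) = 0) \<longrightarrow>
       (\<forall>y\<in>U. (\<Sum>j<n. t j * v j y) = 0)"
    by (elim exE conjE) (rule that)
  have U3: "(\<Sum>j<n. t j * v j y) = 0"
    if "openin X W" "p \<in> W" "\<forall>y\<in>W. (\<Sum>j<n. t j * v j y) = 0" "y \<in> U" for t W y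
    using U0[rule_format, of W t y] that by simp
  show ?case
  \<comment> \<open>If some relation with \<open>t n \<noteq> 0\<close> holds near \<open>p\<close>,
    it eliminates \<open>v n\<close> there, and \<open>U\<close> is shrunk to its domain
    \<open>W\<close>. Otherwise every relation near \<open>p\<close> involves only the first
    \<open>n\<close> functions.\<close>
  proof (cases "\<exists>t W. openin X W \<and> p \<in> W \<and> (\<forall>y\<in>W. (\<Sum>j<Suc n. t j * v j y) = 0) \<and> t n \<noteq> 0")
    case True
    then obtain t W where W: "openin X W" "p \<in> W" "\<forall>y\<in>W. (\<Sum>j<Suc n. t j * v j y) = 0" "t n \<noteq> 0"
      by blast
    have reduce: "(\<Sum>j<Suc n. t' j * v j y) = (\<Sum>j<n. (t' j - t' n * t j / t n) * v j y)" if "y \<in> W" for t' y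
    proof -
      have "(\<Sum>j<Suc n. t j * v j y) = 0" using W(3) that by blast
      then have "(\<Sum>j<n. t j * v j y) = - (t n * v n y)" by simp
      then have t: "(\<Sum>j<n. t j * v j y) = - (t n * v n y)" by simp
      have "(\<Sum>j<n. (t' j - t' n * t j / t n) * v j y)
          = (\<Sum>j<n. t' j * v j y - t' n / t n * (t j * v j y))"
        by (intro sum.cong) (auto simp: left_diff_distrib)
      also have "\<dots> = (\<Sum>j<n. t' j * v j y) - t' n / t n * (\<Sum>j<n. t j * v j y)"
        by (simp only: sum_subtractf sum_distrib_left)
      finally show ?thesis using W(4) by (simp add: t)
    qed
    show ?thesis
    proof (intro exI conjI allI impI ballI)
      show "openin X (U \<inter> W)" "p \<in> U \<inter> W" using U W by auto
      fix t' W' y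
      assume W': "openin X W' \<and> p \<in> W' \<and> (\<forall>y\<in>W'. (\<Sum>j<Suc n. t' j * v j y) = 0)"
        and y: "y \<in> U \<inter> W"
      have "\<forall>y\<in>W' \<inter> W. (\<Sum>j<n. (t' j - t' n * t j / t n) * v j y) = 0"
        using W' reduce by (metis IntD1 IntD2)
      then have "(\<Sum>j<n. (t' j - t' n * t j / t n) * v j y) = 0"
        using U3[of "W' \<inter> W" "\<lambda>j. t' j - t' n * t j / t n" y] W' W y by auto
      then show "(\<Sum>j<Suc n. t' j * v j y) = 0" using reduce y by simp
    qed
  next
    case False
    show ?thesis
    proof (intro exI conjI allI impI ballI)
      show "openin X U" "p \<in> U" using U by auto
      fix t W y
      assume W: "openin X W \<and> p \<in> W \<and> (\<forall>y\<in>W. (\<Sum>j<Suc n. t j * v j y) = 0)" and y: "y \<in> U"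
      then have "t n = 0" using False by blast
      then show "(\<Sum>j<Suc n. t j * v j y) = 0" using U3[of W t y] W y by simp
    qed
  qed
qed

context topological_group
begin

text \<open>All left translates of \<open>f\<close> lie in the span of the \<open>v j\<close>; such
  \<open>f\<close> are called representative functions. Stated as a decomposition, the property
  passes directly to sums and products.\<close>

definition finite_rank :: "('a \<Rightarrow> real) \<Rightarrow> bool" where
  "finite_rank f \<longleftrightarrow> (\<exists>(n::nat) u v. \<forall>x\<in>carrier G. \<forall>y\<in>carrier G. f (x \<otimes> y) = (\<Sum>j<n. u j x * v j y))"

lemma finite_rankI:
  assumes "finite I"
    "\<And>x y. x \<in> carrier G \<Longrightarrow> y \<in> carrier G \<Longrightarrow> f (x \<otimes> y) = (\<Sum>i\<in>I. u i x * v i y)"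
  shows "finite_rank f"
proof -
  obtain g where g: "bij_betw g {..<card I} I"
    using ex_bij_betw_nat_finite[OF assms(1)] by (auto simp: lessThan_atLeast0)
  show ?thesis
    unfolding finite_rank_def
  proof (intro exI ballI)
    fix x y assume xy: "x \<in> carrier G" "y \<in> carrier G"
    show "f (x \<otimes> y) = (\<Sum>j<card I. u (g j) x * v (g j) y)"
      using assms(2)[OF xy] sum.reindex_bij_betw[OF g, of "\<lambda>i. u i x * v i y"] by simp
  qed
qed

lemma finite_rank_cong:
  assumes "\<And>x. x \<in> carrier G \<Longrightarrow> f x = g x"
  shows "finite_rank f \<longleftrightarrow> finite_rank g"
  unfolding finite_rank_def using assms by simp

lemma finite_rank_const: "finite_rank (\<lambda>x. r)"
  by (rule finite_rankI[of "{()}" _ "\<lambda>_ _. r" "\<lambda>_ _. 1"]) auto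

lemma finite_rank_add:
  assumes "finite_rank f" "finite_rank g"
  shows "finite_rank (\<lambda>x. f x + g x)"
proof -
  obtain n u v where f: "\<forall>x\<in>carrier G. \<forall>y\<in>carrier G. f (x \<otimes> y) = (\<Sum>j<(n::nat). u j x * v j y)"
    using assms(1) unfolding finite_rank_def by blast
  obtain m a b where g: "\<forall>x\<in>carrier G. \<forall>y\<in>carrier G. g (x \<otimes> y) = (\<Sum>j<(m::nat). a j x * b j y)"
    using assms(2) unfolding finite_rank_def by blast
  show ?thesis
    by (rule finite_rankI[of "{..<n} <+> {..<m}" _ "case_sum u a" "case_sum v b"])
      (simp_all add: f g sum.Plus)
qed

lemma finite_rank_mult:
  assumes "finite_rank f" "finite_rank g"
  shows "finite_rank (\<lambda>x. f x * g x)"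
proof -
  obtain n u v where f: "\<forall>x\<in>carrier G. \<forall>y\<in>carrier G. f (x \<otimes> y) = (\<Sum>j<(n::nat). u j x * v j y)"
    using assms(1) unfolding finite_rank_def by blast
  obtain m a b where g: "\<forall>x\<in>carrier G. \<forall>y\<in>carrier G. g (x \<otimes> y) = (\<Sum>j<(m::nat). a j x * b j y)"
    using assms(2) unfolding finite_rank_def by blast
  show ?thesis
  proof (rule finite_rankI)
    fix x y assume "x \<in> carrier G" "y \<in> carrier G"
    then have "f (x \<otimes> y) * g (x \<otimes> y) = (\<Sum>i<n. \<Sum>j<m. (u i x * v i y) * (a j x * b j y))"
      by (simp add: f g sum_product)
    also have "\<dots> = (\<Sum>(i, j)\<in>{..<n} \<times> {..<m}. (u i x * v i y) * (a j x * b j y))"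
      by (rule sum.cartesian_product)
    also have "\<dots> = (\<Sum>p\<in>{..<n} \<times> {..<m}. (u (fst p) x * a (snd p) x) * (v (fst p) y * b (snd p) y))"
      by (intro sum.cong) (auto simp: algebra_simps)
    finally show "f (x \<otimes> y) * g (x \<otimes> y) = \<dots>" .
  qed simp
qed

lemma finite_rank_sum:
  assumes "finite I" "\<And>i. i \<in> I \<Longrightarrow> finite_rank (f i)"
  shows "finite_rank (\<lambda>x. \<Sum>i\<in>I. f i x)"
  using assms by (induction I) (auto intro: finite_rank_const finite_rank_add)

lemma finite_rank_matrix_rep: "matrix_rep n c \<Longrightarrow> i < n \<Longrightarrow> j < n \<Longrightarrow> finite_rank (c i j)"
  by (rule finite_rankI[of "{..<n}" _ "\<lambda>k x. c i k x" "\<lambda>k y. c k j y"]) (auto simp: matrix_rep_def)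

lemma finite_rank_matrix_rep_inv:
  "matrix_rep n c \<Longrightarrow> i < n \<Longrightarrow> j < n \<Longrightarrow> finite_rank (\<lambda>x. c i j (inv x))"
  by (rule finite_rankI[of "{..<n}" _ "\<lambda>k x. c k j (inv x)" "\<lambda>k y. c i k (inv y)"])
    (auto simp: matrix_rep_def inv_mult_group mult.commute)

text \<open>
  Finite-rank functions on a connected group behave like analytic ones: since one neighbourhood
  \<open>U\<close> of \<open>\<one>\<close> serves all translates of \<open>f\<close>, the open set of points near which \<open>f\<close> vanishes is
  also closed.
\<close>

theorem finite_rank_identity:
  assumes conn: "connected_space T" and "finite_rank f"
    and V: "openin T V" "V \<noteq> {}" "\<And>x. x \<in> V \<Longrightarrow> f x = 0" and x: "x \<in> carrier G"
  shows "f x = 0"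
proof -
  obtain n u v where f: "\<And>x y. x \<in> carrier G \<Longrightarrow> y \<in> carrier G \<Longrightarrow> f (x \<otimes> y) = (\<Sum>j<(n::nat). u j x * v j y)"
    using assms(2) unfolding finite_rank_def by blast
  obtain U where U: "openin T U" "\<one> \<in> U"
    "\<And>t W y. openin T W \<Longrightarrow> \<one> \<in> W \<Longrightarrow> (\<forall>y\<in>W. (\<Sum>j<n. t j * v j y) = 0) \<Longrightarrow> y \<in> U \<Longrightarrow>
       (\<Sum>j<n. t j * v j y) = 0"
    using uniform_neighbourhood_of_vanishing[where p = \<one> and X = T and n = n and v = v] topspace_eq_carrier one_closed by metis
  define Z where "Z = \<Union>{W. openin T W \<and> (\<forall>x\<in>W. f x = 0)}"
  have opn: "openin T Z" unfolding Z_def by (rule openin_Union) simp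
  have ZG: "Z \<subseteq> carrier G" using openin_subset[OF opn] topspace_eq_carrier by simp
  have fZ: "f x = 0" if "x \<in> Z" for x using that by (auto simp: Z_def)
  \<comment> \<open>The combination with coefficients \<open>u j z\<close> is the translate of
    \<open>f\<close> by \<open>z\<close>. It vanishes near \<open>\<one>\<close>, hence on all of
    \<open>U\<close>.\<close>
  have vanish: "f (z \<otimes> y) = 0" if z: "z \<in> Z" and y: "y \<in> U" for z y
  proof -
    have zG: "z \<in> carrier G" using z ZG by blast
    have yG: "y \<in> carrier G" using U(1) y openin_subset topspace_eq_carrier by blast
    let ?W = "{w \<in> topspace T. z \<otimes> w \<in> Z}"
    have "openin T ?W"
      by (rule openin_continuous_map_preimage[OF _ opn]) (intro group_cont zG)
    moreover have "\<one> \<in> ?W" using z zG by (simp add: topspace_eq_carrier)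
    moreover have "\<forall>w\<in>?W. (\<Sum>j<n. u j z * v j w) = 0"
    proof
      fix w assume w: "w \<in> ?W"
      then have "f (z \<otimes> w) = 0" using fZ by simp
      then show "(\<Sum>j<n. u j z * v j w) = 0" using f[OF zG] w by (simp add: topspace_eq_carrier)
    qed
    ultimately have "(\<Sum>j<n. u j z * v j y) = 0"
      using y by (rule U(3))
    then show ?thesis using f[OF zG yG] by simp
  qed
  have "openin T (topspace T - Z)"
  proof (subst openin_subopen, intro ballI)
    fix y assume y: "y \<in> topspace T - Z"
    then have yG: "y \<in> carrier G" by (simp add: topspace_eq_carrier)
    \<comment> \<open>If such a \<open>z\<close> were in \<open>Z\<close>, then \<open>f\<close>
      would vanish on the translate of \<open>U\<close> by \<open>z\<close>, an open set containing
      \<open>y\<close>.\<close>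
    let ?N = "{z \<in> topspace T. inv z \<otimes> y \<in> U}"
    have N: "openin T ?N"
      by (rule openin_continuous_map_preimage[OF _ U(1)]) (intro group_cont yG)
    have "z \<notin> Z" if z: "z \<in> ?N" for z
    proof
      assume "z \<in> Z"
      have zG: "z \<in> carrier G" using z by (simp add: topspace_eq_carrier)
      let ?W = "{w \<in> topspace T. inv z \<otimes> w \<in> U}"
      have "openin T ?W"
        by (rule openin_continuous_map_preimage[OF _ U(1)]) (intro group_cont inv_closed zG)
      moreover have "f w = 0" if "w \<in> ?W" for w
        using vanish[OF \<open>z \<in> Z\<close>, of "inv z \<otimes> w"] that zG
        by (simp add: topspace_eq_carrier flip: m_assoc)
      moreover have "y \<in> ?W" using z y by simp
      ultimately have "y \<in> Z" unfolding Z_def by blast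
      with y show False by simp
    qed
    moreover have "y \<in> ?N" using yG U(2) by (simp add: topspace_eq_carrier)
    ultimately show "\<exists>N. openin T N \<and> y \<in> N \<and> N \<subseteq> topspace T - Z"
      using N by (intro exI[of _ ?N]) auto
  qed
  then have "closedin T Z" using openin_subset[OF opn] by (simp add: closedin_def)
  moreover have "Z \<noteq> {}" using V by (auto simp: Z_def)
  ultimately have "Z = topspace T" using conn opn unfolding connected_space_clopen_in by blast
  then show ?thesis using fZ x topspace_eq_carrier by simp
qed

text \<open>
  A group word is a list of letters \<open>(i, e)\<close>, standing for the \<open>i\<close>-th generator if \<open>e\<close> is true
  and for its inverse otherwise.
\<close>

primrec weval :: "('i \<Rightarrow> 'a) \<Rightarrow> ('i \<times> bool) list \<Rightarrow> 'a" where
  "weval m [] = \<one>"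
| "weval m (p # w) = (if snd p then m (fst p) else inv (m (fst p))) \<otimes> weval m w"

lemma weval_closed: "(\<And>i. m i \<in> carrier G) \<Longrightarrow> weval m w \<in> carrier G"
  by (induction w) auto

lemma weval_append:
  "(\<And>i. m i \<in> carrier G) \<Longrightarrow> weval m (v @ w) = weval m v \<otimes> weval m w"
  by (induction v) (simp_all add: weval_closed m_assoc)

lemma weval_inverse:
  assumes "\<And>i. m i \<in> carrier G"
  shows "weval m (rev (map (\<lambda>p. (fst p, \<not> snd p)) w)) = inv (weval m w)"
proof (induction w)
  case (Cons p w)
  then show ?case
    using assms weval_append[of m, OF assms] weval_closed[of m, OF assms]
    by (simp add: inv_mult_group)
qed simp

lemma weval_one: "weval (\<lambda>i. \<one>) w = \<one>"
  by (induction w) auto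

lemma continuous_map_weval:
  "continuous_map (product_topology (\<lambda>_. T) UNIV) T (\<lambda>m. weval m w)"
proof (induction w)
  case (Cons p w)
  have "continuous_map (product_topology (\<lambda>_. T) UNIV) T (\<lambda>m. m (fst p))"
    by (rule continuous_map_product_projection) simp
  then show ?case
    using Cons by (cases "snd p") (simp_all add: continuous_map_mult continuous_map_inv)
qed (simp add: topspace_eq_carrier)

text \<open>Matrix multiplication expands the coefficient into products of coefficients of single
  letters, each being \<open>x\<close>, its inverse or a constant. The row index changes along the
  word, so the induction generalizes it.\<close>

lemma finite_rank_weval:
  assumes c: "matrix_rep n c" and m: "\<And>i. m i \<in> carrier G"
  shows "i < n \<Longrightarrow> j < n \<Longrightarrow> finite_rank (\<lambda>x. c i j (weval (m(l := x)) w))"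
proof (induction w arbitrary: i)
  case Nil
  then show ?case by (simp add: finite_rank_const)
next
  case (Cons p w)
  define g where "g = (\<lambda>x. if snd p then (m(l := x)) (fst p) else inv ((m(l := x)) (fst p)))"
  have g: "g x \<in> carrier G" if "x \<in> carrier G" for x
    using that m by (auto simp: g_def)
  have "finite_rank (\<lambda>x. \<Sum>k<n. c i k (g x) * c k j (weval (m(l := x)) w))"
  proof (intro finite_rank_sum finite_rank_mult)
    fix k assume k: "k \<in> {..<n}"
    show "finite_rank (\<lambda>x. c i k (g x))"
      using finite_rank_matrix_rep[OF c Cons.prems(1), of k]
        finite_rank_matrix_rep_inv[OF c Cons.prems(1), of k] finite_rank_const k
      by (cases "fst p = l"; cases "snd p") (auto simp: g_def)
    show "finite_rank (\<lambda>x. c k j (weval (m(l := x)) w))"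
      using Cons.IH[of k] Cons.prems(2) k by (simp del: fun_upd_apply)
  qed simp
  also have "?this \<longleftrightarrow> finite_rank (\<lambda>x. c i j (weval (m(l := x)) (p # w)))"
  proof (rule finite_rank_cong)
    fix x assume x: "x \<in> carrier G"
    have "weval (m(l := x)) w \<in> carrier G" by (rule weval_closed) (use x m in auto)
    then show "(\<Sum>k<n. c i k (g x) * c k j (weval (m(l := x)) w)) = c i j (weval (m(l := x)) (p # w))"
      using c Cons.prems g[OF x] by (simp add: g_def matrix_rep_def)
  qed
  finally show ?case .
qed

text \<open>A basic box inside \<open>U\<close> restricts finitely many coordinates. These are
  released one at a time by the identity theorem, applied to the coefficient minus \<open>r\<close>
  as a function of that coordinate.\<close>

lemma matrix_coefficient_of_word_constant:
  assumes conn: "connected_space T" and c: "matrix_rep n c" "i < n" "j < n"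
    and U: "openin (product_topology (\<lambda>_. T) UNIV) U" "U \<noteq> {}"
    and const: "\<And>m. m \<in> U \<Longrightarrow> c i j (weval m w) = r"
    and m: "\<And>l. m l \<in> carrier G"
  shows "c i j (weval m w) = r"
proof -
  obtain m0 where m0: "m0 \<in> U" using U(2) by blast
  then obtain V where V: "finite {l. V l \<noteq> topspace T}" "\<And>l. openin T (V l)"
    "m0 \<in> Pi\<^sub>E UNIV V" "Pi\<^sub>E UNIV V \<subseteq> U"
    using U(1) unfolding openin_product_topology_alt by auto
  have step: "\<And>m. (\<forall>l. m l \<in> carrier G) \<Longrightarrow> (\<forall>l. l \<notin> K \<longrightarrow> m l \<in> V l) \<Longrightarrow> c i j (weval m w) = r"
    if "finite K" for K
    using that
  proof (induction K)
    case empty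
    then have "m \<in> Pi\<^sub>E UNIV V" by auto
    then show ?case using V(4) const by blast
  next
    case (insert a K)
    let ?f = "\<lambda>x. c i j (weval (m(a := x)) w) + (- r)"
    have "finite_rank ?f"
      by (intro finite_rank_add finite_rank_const finite_rank_weval[OF c(1) _ c(2,3)])
        (use insert.prems in blast)
    moreover have "V a \<noteq> {}" using V(3) by auto
    moreover have "?f x = 0" if "x \<in> V a" for x
    proof -
      have "x \<in> carrier G" using V(2) that openin_subset topspace_eq_carrier by blast
      then have "c i j (weval (m(a := x)) w) = r"
        using insert.prems that by (intro insert.IH) auto
      then show ?thesis by simp
    qed
    moreover have "m a \<in> carrier G" using insert.prems by blast
    ultimately have "?f (m a) = 0" by (rule finite_rank_identity[OF conn _ V(2)])
    then show ?case by simp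
  qed
  show ?thesis
    by (rule step[OF V(1)]) (use m in \<open>auto simp: topspace_eq_carrier\<close>)
qed

end

section \<open>Dense subgroups with trivial pairwise intersections\<close>

context topological_group
begin

section \<open>Congruence modulo a representation\<close>

definition rep_eq :: "nat \<Rightarrow> (nat \<Rightarrow> nat \<Rightarrow> 'a \<Rightarrow> real) \<Rightarrow> 'a \<Rightarrow> 'a \<Rightarrow> bool" where
  "rep_eq n c x y \<longleftrightarrow> (\<forall>i<n. \<forall>j<n. c i j x = c i j y)"

lemma rep_eq_mult:
  assumes "matrix_rep n c" "rep_eq n c x x'" "rep_eq n c y y'"
    and "x \<in> carrier G" "x' \<in> carrier G" "y \<in> carrier G" "y' \<in> carrier G"
  shows "rep_eq n c (x \<otimes> y) (x' \<otimes> y')"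
  using assms by (simp add: rep_eq_def matrix_rep_def)

text \<open>Pure multiplicativity: in \<open>inv x \<otimes> (x' \<otimes> inv x')\<close>, which is
  \<open>inv x\<close>, the factor \<open>x'\<close> may be replaced by \<open>x\<close>, and the
  result is \<open>inv x'\<close>.\<close>

lemma rep_eq_inv:
  assumes c: "matrix_rep n c" and e: "rep_eq n c x x'" and x: "x \<in> carrier G" "x' \<in> carrier G"
  shows "rep_eq n c (inv x) (inv x')"
proof -
  have "rep_eq n c (x' \<otimes> inv x') (x \<otimes> inv x')"
    by (rule rep_eq_mult[OF c]) (use e x in \<open>auto simp: rep_eq_def\<close>)
  then have "rep_eq n c (inv x \<otimes> (x' \<otimes> inv x')) (inv x \<otimes> (x \<otimes> inv x'))"
    by (rule rep_eq_mult[OF c, rotated]) (use x in \<open>auto simp: rep_eq_def\<close>)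
  moreover have "inv x \<otimes> (x \<otimes> inv x') = inv x'" using x by (simp flip: m_assoc)
  ultimately show ?thesis using x by simp
qed

lemma rep_eq_weval:
  assumes c: "matrix_rep n c" and e: "\<And>i. rep_eq n c (m i) (m' i)"
    and m: "\<And>i. m i \<in> carrier G" "\<And>i. m' i \<in> carrier G"
  shows "rep_eq n c (weval m w) (weval m' w)"
proof (induction w)
  case (Cons p w)
  have "rep_eq n c (if snd p then m (fst p) else inv (m (fst p)))
      (if snd p then m' (fst p) else inv (m' (fst p)))"
    using e m rep_eq_inv[OF c] by simp
  then show ?case
    using rep_eq_mult[OF c _ Cons] m weval_closed[of m, OF m(1)] weval_closed[of m', OF m(2)] by simp
qed (simp add: rep_eq_def)

lemma subgroup_range_weval:
  assumes "\<And>i. m i \<in> carrier G"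
  shows "subgroup (range (weval m)) G"
proof
  show "range (weval m) \<subseteq> carrier G" using weval_closed[of m, OF assms] by blast
  fix x y assume x: "x \<in> range (weval m)" and y: "y \<in> range (weval m)"
  then obtain v w where "x = weval m v" "y = weval m w" by blast
  then have "x \<otimes> y = weval m (v @ w)"
    using weval_append[of m, OF assms] by simp
  then show "x \<otimes> y \<in> range (weval m)" by blast
next
  show "\<one> \<in> range (weval m)" using weval.simps(1) by (metis rangeI)
next
  fix x assume "x \<in> range (weval m)"
  then obtain w where "x = weval m w" by blast
  then have "inv x = weval m (rev (map (\<lambda>p. (fst p, \<not> snd p)) w))"
    using weval_inverse[of m, OF assms] by simp
  then show "inv x \<in> range (weval m)" by blast
qed

lemma countable_range_weval: "countable (range (weval (m :: 'i :: countable \<Rightarrow> 'a)))"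
  by simp

definition law :: "('i \<times> bool) list \<Rightarrow> bool" where
  "law w \<longleftrightarrow> (\<forall>m. (\<forall>i. m i \<in> carrier G) \<longrightarrow> weval m w = \<one>)"

end

context compact_separable_group
begin

theorem continuum_many_dense_subgroups:
  assumes conn: "connected_space T"
  shows "\<exists>D :: (nat \<Rightarrow> bool) \<Rightarrow> 'a set.
    (\<forall>\<tau>. subgroup (D \<tau>) G \<and> countable (D \<tau>) \<and> T closure_of (D \<tau>) = topspace T) \<and>
    (\<forall>\<tau> \<tau>'. \<tau> \<noteq> \<tau>' \<longrightarrow> D \<tau> \<inter> D \<tau>' = {\<one>})"
proof -
  let ?X = "product_topology (\<lambda>_. T) (UNIV :: (nat \<times> nat) set)"
  have topX: "m \<in> topspace ?X \<longleftrightarrow> (\<forall>i. m i \<in> carrier G)" for m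
    by (auto simp: topspace_eq_carrier)
  \<comment> \<open>a law gets the empty representation, about which nothing is claimed\<close>
  have "\<exists>n c i j. matrix_rep n c \<and> (\<not> law w \<longrightarrow> i < n \<and> j < n \<and>
      (\<exists>m. (\<forall>l. m l \<in> carrier G) \<and> c i j (weval m w) \<noteq> c i j \<one>))" for w :: "((nat \<times> nat) \<times> bool) list"
  proof (cases "law w")
    case True
    then show ?thesis by (intro exI[of _ 0]) (simp add: matrix_rep_def)
  next
    case False
    then obtain m where m: "\<forall>l. m l \<in> carrier G" "weval m w \<noteq> \<one>" unfolding law_def by blast
    then have "weval m w \<in> carrier G" by (intro weval_closed) blast
    then show ?thesis using Peter_Weyl[OF _ m(2)] m(1) by metis
  qed
  then obtain N C I J where C: "\<And>w. matrix_rep (N w) (C w)"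
    and IJ: "\<And>w :: ((nat \<times> nat) \<times> bool) list. \<not> law w \<Longrightarrow> I w < N w \<and> J w < N w \<and>
      (\<exists>m. (\<forall>l. m l \<in> carrier G) \<and> C w (I w) (J w) (weval m w) \<noteq> C w (I w) (J w) \<one>)"
    by metis
  have CR_C: "CR (C w p q)" if "p < N w" "q < N w" for w p q
    using C[of w] that by (simp add: matrix_rep_def)

  obtain A where A: "countable A" "A \<subseteq> topspace T" "T closure_of A = topspace T"
    using separable unfolding separable_space_def by blast
  have "A \<noteq> {}" using A(3) one_closed topspace_eq_carrier by auto
  define x where "x = from_nat_into A"
  have x_range: "range x = A" unfolding x_def using \<open>A \<noteq> {}\<close> A(1) by (rule range_from_nat_into)
  have xG: "x n \<in> carrier G" for n using x_range A(2) topspace_eq_carrier by auto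

  define W :: "nat \<Rightarrow> ((nat \<times> nat) \<times> bool) list" where "W = from_nat"
  \<comment> \<open>A pseudometric for the first \<open>i\<close> representations. Bounds by
    \<open>1 / real (Suc i)\<close> for all \<open>i\<close> force agreement in every
    representation.\<close>
  define dd where "dd = (\<lambda>i a b. \<Sum>j<i. \<Sum>p<N (W j). \<Sum>q<N (W j). \<bar>C (W j) p q a - C (W j) p q b\<bar>)"
  have CR_dd: "CR (\<lambda>y. dd i y b)" for i b
    unfolding dd_def by (intro continuous_map_sum continuous_map_real_abs continuous_map_diff CR_C) auto
  have dd_mono: "dd i a b \<le> dd i' a b" if "i \<le> i'" for i i' a b
    unfolding dd_def using that by (intro sum_mono2) (auto intro!: sum_nonneg)
  have dd_ge: "\<bar>C (W j) p q a - C (W j) p q b\<bar> \<le> dd i a b"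
    if "j < i" "p < N (W j)" "q < N (W j)" for i j p q a b
  proof -
    have "\<bar>C (W j) p q a - C (W j) p q b\<bar> \<le> (\<Sum>q<N (W j). \<bar>C (W j) p q a - C (W j) p q b\<bar>)"
      using that by (intro member_le_sum) auto
    also have "\<dots> \<le> (\<Sum>p<N (W j). \<Sum>q<N (W j). \<bar>C (W j) p q a - C (W j) p q b\<bar>)"
      using that by (intro member_le_sum[of p]) (auto intro: sum_nonneg)
    also have "\<dots> \<le> dd i a b"
      unfolding dd_def using that by (intro member_le_sum[of j]) (auto intro!: sum_nonneg)
    finally show ?thesis .
  qed

  \<comment> \<open>Two kinds of demands in one countable type: \<open>Inl\<close> separates word
    values at two tuples, \<open>Inr\<close> makes row \<open>n\<close> of the first tuple approach
    \<open>x n\<close>.\<close>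
  define R where "R = (\<lambda>t (m :: nat \<times> nat \<Rightarrow> 'a) (m' :: nat \<times> nat \<Rightarrow> 'a). case t of
      Inl (w, w') \<Rightarrow> \<not> law w \<and> \<not> law w' \<longrightarrow>
        C w (I w) (J w) (weval m w) \<noteq> C w (I w) (J w) (weval m' w')
    | Inr (n, i) \<Rightarrow> \<exists>k. dd i (m (n, k)) (x n) < 1 / real (Suc i))"
  have R_open: "\<exists>V' W'. openin ?X V' \<and> V' \<noteq> {} \<and> V' \<subseteq> V \<and> openin ?X W' \<and> W' \<noteq> {} \<and> W' \<subseteq> U \<and>
        (\<forall>m\<in>V'. \<forall>m'\<in>W'. R t m m')"
    if V: "openin ?X V" "V \<noteq> {}" and U: "openin ?X U" "U \<noteq> {}" for t V U
  proof (cases t)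
    case (Inl ww)
    obtain w w' where ww: "ww = (w, w')" by (cases ww)
    show ?thesis
    proof (cases "law w \<or> law w'")
      case True
      then show ?thesis using V U Inl ww by (intro exI[of _ V] exI[of _ U]) (auto simp: R_def)
    next
      case False
      let ?f = "C w (I w) (J w)"
      obtain b where b: "b \<in> U" using U(2) by blast
      have f: "I w < N w" "J w < N w" using IJ False by auto
      \<comment> \<open>Otherwise the coefficient is constant on \<open>V\<close>, hence on all
        tuples, including the trivial one with value \<open>?f \<one>\<close>; this contradicts the
        choice of the representation for \<open>w\<close>.\<close>
      have "\<exists>a\<in>V. ?f (weval a w) \<noteq> ?f (weval b w')"
      proof (rule ccontr)
        assume "\<not> ?thesis"
        then have const: "?f (weval m w) = ?f (weval b w')" if "m \<in> V" for m
          using that by blast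
        have all: "?f (weval m w) = ?f (weval b w')" if "\<And>l. m l \<in> carrier G" for m
          by (rule matrix_coefficient_of_word_constant[OF conn C f V const that])
        obtain m where m: "\<forall>l. m l \<in> carrier G" "?f (weval m w) \<noteq> ?f \<one>"
          using IJ[of w] False by blast
        have "?f (weval m w) = ?f (weval b w')" by (rule all) (use m(1) in blast)
        moreover have "?f (weval (\<lambda>_. \<one>) w) = ?f (weval b w')" by (rule all) simp
        ultimately show False using m(2) by (simp only: weval_one)
      qed
      then obtain a where a: "a \<in> V" "?f (weval a w) \<noteq> ?f (weval b w')" by blast
      have "\<exists>V' W'. openin ?X V' \<and> V' \<noteq> {} \<and> V' \<subseteq> V \<and> openin ?X W' \<and> W' \<noteq> {} \<and> W' \<subseteq> U \<and>
        (\<forall>m\<in>V'. \<forall>m'\<in>W'. ?f (weval m w) \<noteq> ?f (weval m' w'))"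
        by (rule separate_values[where f = "\<lambda>m. ?f (weval m w)" and g = "\<lambda>m. ?f (weval m w')",
              OF _ _ V(1) U(1) a(1) b a(2)])
          (rule continuous_map_real_comp[OF CR_C[OF f] continuous_map_weval])+
      then show ?thesis using False by (simp add: R_def Inl ww)
    qed
  next
    case (Inr ni)
    obtain n i where ni: "ni = (n, i)" by (cases ni)
    obtain m0 where "m0 \<in> V" using V(2) by blast
    then obtain B where B: "finite {l. B l \<noteq> topspace T}" "\<And>l. openin T (B l)"
      "m0 \<in> Pi\<^sub>E UNIV B" "Pi\<^sub>E UNIV B \<subseteq> V"
      using V(1) unfolding openin_product_topology_alt by auto
    \<comment> \<open>Row \<open>n\<close> has infinitely many entries, so the box leaves one of
      them free, and \<open>x n\<close> itself can be put there.\<close>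
    have "infinite (range (\<lambda>k :: nat. (n, k)))"
      by (rule range_inj_infinite) (simp add: inj_on_def)
    then obtain k where k: "B (n, k) = topspace T"
      using finite_subset[OF _ B(1), of "range (\<lambda>k. (n, k))"] by blast
    let ?m = "m0((n, k) := x n)"
    let ?V = "V \<inter> {m \<in> topspace ?X. dd i (m (n, k)) (x n) \<in> {..<1 / real (Suc i)}}"
    have "continuous_map ?X T (\<lambda>m. m (n, k))"
      by (rule continuous_map_product_projection) simp
    then have "continuous_map ?X euclideanreal (\<lambda>m. dd i (m (n, k)) (x n))"
      by (rule continuous_map_real_comp[OF CR_dd])
    then have "openin ?X ?V"
      by (intro openin_Int V openin_continuous_map_preimage) auto
    moreover have "?m \<in> ?V"
    proof -
      have "?m \<in> Pi\<^sub>E UNIV B"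
        using B(3) k xG by (auto simp: topspace_eq_carrier PiE_iff)
      then have "?m \<in> V" using B(4) by blast
      moreover have "dd i (x n) (x n) = 0" by (simp add: dd_def)
      ultimately show ?thesis using openin_subset[OF V(1)] by auto
    qed
    ultimately show ?thesis
      using U by (intro exI[of _ ?V] exI[of _ U]) (auto simp: R_def Inr ni)
  qed

  have cX: "compact_space ?X" by (simp add: compact_space_product_topology compact)
  have hX: "Hausdorff_space ?X" by (simp add: Hausdorff_space_product_topology Hausdorff)
  have "(\<lambda>_. \<one>) \<in> topspace ?X" by (rule topX[THEN iffD2]) simp
  then have nX: "topspace ?X \<noteq> {}" by blast
  have "\<exists>\<phi> :: (nat \<Rightarrow> bool) \<Rightarrow> nat \<times> nat \<Rightarrow> 'a. (\<forall>\<tau>. \<phi> \<tau> \<in> topspace ?X) \<and>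
      (\<forall>\<tau> \<tau>' k. \<tau> \<noteq> \<tau>' \<longrightarrow> R (from_nat k) (\<phi> \<tau>) (\<phi> \<tau>'))"
    by (rule Mycielski[OF cX hX nX]) (rule R_open)
  then obtain \<phi> :: "(nat \<Rightarrow> bool) \<Rightarrow> nat \<times> nat \<Rightarrow> 'a" where \<phi>X: "\<forall>\<tau>. \<phi> \<tau> \<in> topspace ?X"
    and \<phi>R0: "\<forall>\<tau> \<tau>' k. \<tau> \<noteq> \<tau>' \<longrightarrow> R (from_nat k) (\<phi> \<tau>) (\<phi> \<tau>')"
    by (elim exE conjE) (rule that)
  have \<phi>G: "\<phi> \<tau> i \<in> carrier G" for \<tau> i using \<phi>X topX by blast
  have \<phi>R: "R t (\<phi> \<tau>) (\<phi> \<tau>')" if "\<tau> \<noteq> \<tau>'" for t \<tau> \<tau>'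
    using \<phi>R0[rule_format, OF that, of "to_nat t"] by simp
  have \<phi>_close: "\<exists>k. dd i (\<phi> \<tau> (n, k)) (x n) < 1 / real (Suc i)" for \<tau> n i
  proof -
    \<comment> \<open>Demands are imposed on pairs of different branches; this one ignores the
      second, so any other branch will do.\<close>
    have "\<tau> \<noteq> (\<lambda>k. \<not> \<tau> k)" by (metis (full_types))
    from \<phi>R[OF this, of "Inr (n, i)"] show ?thesis by (simp add: R_def)
  qed

  have "\<exists>z\<in>carrier G. z \<in> T closure_of (range (\<lambda>k. \<phi> \<tau> (n, k))) \<and> (\<forall>w. rep_eq (N w) (C w) z (x n))" for \<tau> n
  proof -
    \<comment> \<open>A point in the closures of all these decreasing sets is both a cluster point
      of the row and congruent to \<open>x n\<close> in every representation.\<close>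
    define E where "E = (\<lambda>i. {\<phi> \<tau> (n, k) |k. dd i (\<phi> \<tau> (n, k)) (x n) < 1 / real (Suc i)})"
    have EG: "E i \<subseteq> topspace T" for i using \<phi>G by (auto simp: E_def topspace_eq_carrier)
    have "(\<Inter>i. T closure_of (E i)) \<noteq> {}"
    proof (rule compact_space_imp_nest[OF compact])
      show "closedin T (T closure_of (E i))" for i by simp
      show "T closure_of (E i) \<noteq> {}" for i
        using \<phi>_close[of i \<tau> n] closure_of_subset[OF EG, of i] by (auto simp: E_def)
      show "decseq (\<lambda>i. T closure_of (E i))"
      proof (intro decseq_SucI closure_of_mono)
        fix i
        have "1 / real (Suc (Suc i)) \<le> 1 / real (Suc i)" by (intro divide_left_mono) auto
        moreover have "dd i a b \<le> dd (Suc i) a b" for a b by (rule dd_mono) simp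
        ultimately have "dd i a b < 1 / real (Suc i)" if "dd (Suc i) a b < 1 / real (Suc (Suc i))" for a b
          using that by (meson order.strict_trans1 order.strict_trans2)
        then show "E (Suc i) \<subseteq> E i" unfolding E_def by blast
      qed
    qed
    then obtain z where z: "\<And>i. z \<in> T closure_of (E i)" by auto
    then have zG: "z \<in> carrier G" using closure_of_subset_topspace topspace_eq_carrier by (metis subsetD)
    have "E 0 \<subseteq> range (\<lambda>k. \<phi> \<tau> (n, k))" by (auto simp: E_def)
    then have "z \<in> T closure_of (range (\<lambda>k. \<phi> \<tau> (n, k)))"
      using z[of 0] closure_of_mono by (metis subsetD)
    moreover have dz: "dd i z (x n) \<le> 1 / real (Suc i)" for i
    proof -
      have "closedin T {y \<in> topspace T. dd i y (x n) \<in> {..1 / real (Suc i)}}"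
        by (rule closedin_continuous_map_preimage[OF CR_dd]) simp
      moreover have "E i \<subseteq> {y \<in> topspace T. dd i y (x n) \<in> {..1 / real (Suc i)}}"
        using EG by (auto simp: E_def less_imp_le)
      ultimately have "T closure_of (E i) \<subseteq> {y \<in> topspace T. dd i y (x n) \<in> {..1 / real (Suc i)}}"
        by (rule closure_of_minimal[rotated])
      then show ?thesis using z[of i] by auto
    qed
    have "rep_eq (N w) (C w) z (x n)" for w
      unfolding rep_eq_def
    proof (intro allI impI)
      fix p q assume pq: "p < N w" "q < N w"
      define j where "j = to_nat w"
      have w: "w = W j" by (simp add: W_def j_def)
      have "\<bar>C w p q z - C w p q (x n)\<bar> \<le> 0 + e" if e: "e > 0" for e
      proof -
        obtain i where i: "inverse (real (Suc i)) < e" using reals_Archimedean[OF e] by blast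
        \<comment> \<open>Above \<open>j\<close>, so that \<open>dd ?i\<close> sees the word
          \<open>w\<close>, and above \<open>i\<close>, so that the error is below
          \<open>e\<close>.\<close>
        let ?i = "Suc (max i j)"
        have "\<bar>C w p q z - C w p q (x n)\<bar> \<le> dd ?i z (x n)"
          unfolding w by (rule dd_ge) (use pq w in auto)
        also have "\<dots> \<le> 1 / real (Suc ?i)" by (rule dz)
        also have "\<dots> \<le> 1 / real (Suc i)" by (intro divide_left_mono) auto
        finally show ?thesis using i by (simp add: inverse_eq_divide)
      qed
      then have "\<bar>C w p q z - C w p q (x n)\<bar> \<le> 0" by (rule field_le_epsilon)
      then show "C w p q z = C w p q (x n)" by simp
    qed
    ultimately show ?thesis using zG by blast
  qed
  then obtain z where z: "\<And>\<tau> n. z \<tau> n \<in> carrier G"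
    "\<And>\<tau> n. z \<tau> n \<in> T closure_of (range (\<lambda>k. \<phi> \<tau> (n, k)))"
    "\<And>\<tau> n w. rep_eq (N w) (C w) (z \<tau> n) (x n)"
    by metis

  \<comment> \<open>translating by \<open>inv (z \<tau> n) \<otimes> x n\<close> moves the cluster point \<open>z \<tau> n\<close> to \<open>x n\<close> but is invisible
    to the representations \<open>C w\<close>\<close>
  define g where "g = (\<lambda>\<tau> (n, k). \<phi> \<tau> (n, k) \<otimes> (inv (z \<tau> n) \<otimes> x n))"
  have gG: "g \<tau> i \<in> carrier G" for \<tau> i using \<phi>G z(1) xG by (cases i) (simp add: g_def)
  have g_eq: "rep_eq (N w) (C w) (g \<tau> i) (\<phi> \<tau> i)" for \<tau> i w
  proof (cases i)
    case (Pair n k)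
    have xz: "rep_eq (N w) (C w) (x n) (z \<tau> n)" using z(3) by (simp add: rep_eq_def)
    have refl: "rep_eq (N w) (C w) y y" for y by (simp add: rep_eq_def)
    have "rep_eq (N w) (C w) (\<phi> \<tau> i \<otimes> (inv (z \<tau> n) \<otimes> x n)) (\<phi> \<tau> i \<otimes> (inv (z \<tau> n) \<otimes> z \<tau> n))"
      by (intro rep_eq_mult[OF C] refl xz) (use \<phi>G z(1) xG in auto)
    then show ?thesis using \<phi>G z(1) by (simp add: g_def Pair)
  qed
  define D where "D = (\<lambda>\<tau>. range (weval (g \<tau>)))"
  have D_sub: "subgroup (D \<tau>) G" for \<tau>
    unfolding D_def using subgroup_range_weval gG .
  have D_dense: "T closure_of (D \<tau>) = topspace T" for \<tau>
  proof -
    have "x n \<in> T closure_of (D \<tau>)" for n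
    proof -
      let ?h = "\<lambda>y. y \<otimes> (inv (z \<tau> n) \<otimes> x n)"
      let ?S = "range (\<lambda>k. \<phi> \<tau> (n, k))"
      have "continuous_map T T ?h" by (intro group_cont m_closed inv_closed z(1) xG)
      then have "?h ` (T closure_of ?S) \<subseteq> T closure_of (?h ` ?S)"
        by (rule continuous_map_image_closure_subset)
      moreover have "?h (z \<tau> n) = x n" using z(1) xG by (simp flip: m_assoc)
      ultimately have "x n \<in> T closure_of (?h ` ?S)" using z(2) by (metis image_eqI subsetD)
      moreover have "?h ` ?S \<subseteq> D \<tau>"
      proof clarify
        fix k
        have "?h (\<phi> \<tau> (n, k)) = weval (g \<tau>) [((n, k), True)]"
          using gG[of \<tau> "(n, k)"] by (simp add: g_def)
        then show "?h (\<phi> \<tau> (n, k)) \<in> D \<tau>" unfolding D_def by (metis rangeI)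
      qed
      ultimately show ?thesis using closure_of_mono by (metis subsetD)
    qed
    then have "A \<subseteq> T closure_of (D \<tau>)" using x_range by blast
    then have "T closure_of A \<subseteq> T closure_of (D \<tau>)" by (simp add: closure_of_minimal)
    then show ?thesis using A(3) closure_of_subset_topspace by (metis subset_antisym)
  qed
  have D_disj: "D \<tau> \<inter> D \<tau>' = {\<one>}" if ne: "\<tau> \<noteq> \<tau>'" for \<tau> \<tau>'
  proof -
    have "d = \<one>" if d: "d \<in> D \<tau>" "d \<in> D \<tau>'" for d
    proof (rule ccontr)
      assume "d \<noteq> \<one>"
      obtain w w' where w: "d = weval (g \<tau>) w" "d = weval (g \<tau>') w'" using d unfolding D_def by blast
      \<comment> \<open>Both words take the nontrivial value \<open>d\<close>, so neither is a law
        and the separating demand for the pair applies.\<close>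
      have nl: "\<not> law w" "\<not> law w'" using \<open>d \<noteq> \<one>\<close> w gG unfolding law_def by metis+
      have f: "I w < N w" "J w < N w" using IJ nl by auto
      have "rep_eq (N w) (C w) (weval (g \<tau>) v) (weval (\<phi> \<tau>) v)" for v \<tau>
        by (rule rep_eq_weval[OF C g_eq gG \<phi>G])
      then have "C w (I w) (J w) d = C w (I w) (J w) (weval (\<phi> \<tau>) w)"
        "C w (I w) (J w) d = C w (I w) (J w) (weval (\<phi> \<tau>') w')"
        using f w unfolding rep_eq_def by metis+
      then show False using \<phi>R[OF ne, of "Inl (w, w')"] nl by (simp add: R_def)
    qed
    moreover have "\<one> \<in> D \<tau>" "\<one> \<in> D \<tau>'" using D_sub subgroup.one_closed by blast+
    ultimately show ?thesis by blast
  qed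
  show ?thesis
  proof (intro exI[of _ D] conjI allI impI)
    show "countable (D \<tau>)" for \<tau> unfolding D_def by (rule countable_range_weval)
  qed (simp_all add: D_sub D_dense D_disj)
qed

end

section \<open>Counting the subgroups that meet a small subgroup nontrivially\<close>

theorem theorem3p16:
  fixes G :: "('a, 'b) monoid_scheme" and T :: "'a topology"
  assumes "topological_group G T"
    and "nontrivial_group G"
    and "separable_space T"
    and "connected_space T"
    and "compact_space T"
  shows "d_independent G T"
proof -
  interpret compact_separable_group G T
    using assms(1,3,5) by (simp add: compact_separable_group_def compact_separable_group_axioms_def)
  obtain D :: "(nat \<Rightarrow> bool) \<Rightarrow> 'a set" where
    D: "\<forall>\<tau>. subgroup (D \<tau>) G \<and> countable (D \<tau>) \<and> T closure_of (D \<tau>) = topspace T"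
    and disj: "\<forall>\<tau> \<tau>'. \<tau> \<noteq> \<tau>' \<longrightarrow> D \<tau> \<inter> D \<tau>' = {\<one>\<^bsub>G\<^esub>}"
    using continuum_many_dense_subgroups[OF assms(4)] by (elim exE conjE) (rule that)
  have "\<exists>\<tau>. S \<inter> D \<tau> = {\<one>\<^bsub>G\<^esub>}" if S: "subgroup S G" "S \<prec> (UNIV :: real set)" for S
  proof (rule ccontr)
    assume "\<nexists>\<tau>. S \<inter> D \<tau> = {\<one>\<^bsub>G\<^esub>}"
    moreover have "\<one>\<^bsub>G\<^esub> \<in> S \<inter> D \<tau>" for \<tau>
      using S(1) D by (simp add: subgroup.one_closed)
    ultimately have "\<exists>s. s \<in> S \<inter> D \<tau> \<and> s \<noteq> \<one>\<^bsub>G\<^esub>" for \<tau> by blast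
    then obtain s where s: "\<And>\<tau>. s \<tau> \<in> S \<inter> D \<tau> \<and> s \<tau> \<noteq> \<one>\<^bsub>G\<^esub>" by metis
    have "inj s"
    proof (rule injI, rule ccontr)
      fix \<tau> \<tau>' assume "s \<tau> = s \<tau>'" "\<tau> \<noteq> \<tau>'"
      then have "s \<tau> \<in> D \<tau> \<inter> D \<tau>'" using s[of \<tau>] s[of \<tau>'] by simp
      then show False using disj \<open>\<tau> \<noteq> \<tau>'\<close> s[of \<tau>] by simp
    qed
    then have seq_le: "(UNIV :: (nat \<Rightarrow> bool) set) \<lesssim> S"
      unfolding lepoll_def using s by (intro exI[of _ s] conjI image_subsetI) auto
    have set_le: "(UNIV :: nat set set) \<lesssim> (UNIV :: (nat \<Rightarrow> bool) set)"
    proof -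
      have "inj (\<lambda>A (n :: nat). n \<in> A)"
        by (rule inj_on_inverseI[of _ Collect]) simp
      then show ?thesis unfolding lepoll_def by blast
    qed
    have real_le: "(UNIV :: real set) \<lesssim> (UNIV :: nat set set)"
      by (rule eqpoll_imp_lepoll[OF eqpoll_sym[OF nat_sets_eqpoll_reals]])
    have "(UNIV :: real set) \<lesssim> S"
      by (rule lepoll_trans[OF real_le lepoll_trans[OF set_le seq_le]])
    then have "S \<approx> (UNIV :: real set)"
      by (rule lepoll_antisym[OF lesspoll_imp_lepoll[OF S(2)]])
    with S(2) show False by (simp add: lesspoll_def)
  qed
  with assms(1,2) D show ?thesis
    unfolding d_independent_def by meson
qed

end
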